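(* Let $G$ be a Lie group with Lie algebra $\mathfrak{g}$, acting smoothly and properly on a smooth manifold $M$. For each $\xi\in\mathfrak{g}$, let $\xi_M$ be the infinitesimal generator of the $G$-action. Suppose that there exists a $G$-invariant function $h\in C^\infty(M)$ with no critical points. Then, for every $G$-invariant Riemannian metric $g$ on $M$, the assignment $$\xi\mapsto\pi_\xi:=\frac{\nabla h}{g(\nabla h,\nabla h)}\wedge\xi_M$$ is a linear map from $\mathfrak{g}$ to a vector space of Poisson structures of rank at most two on $M$ such that $\pi_\xi^\sharp\,\mathrm{d}h=\xi_M$ for every $\xi\in\mathfrak{g}$.
   Context: $\nabla h$ is the gradient of $h$ with respect to $g$. A Poisson structure is a bivector field $\pi$ with $[\pi,\pi]=0$ (Schouten–Nijenhuis bracket); $\pi^\sharp\alpha=\mathbf{i}_\alpha\pi=\pi(\alpha,\cdot)$, so $(Y\wedge X)^\sharp\alpha=\alpha(Y)X-\alpha(X)Y$; the rank of $\pi$ at $x$ is $\dim\pi^\sharp(T_x^*M)$. *)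

theory Defs
  imports "HOL-Analysis.Analysis" "HOL-Library.Function_Algebras"
begin

text \<open>Tangent vectors, covectors and multivectors are functions; with the pointwise operations
  they live in real vector spaces, so \<^const>\<open>subspace\<close> and \<^const>\<open>dim\<close> apply to sets of them.\<close>

instantiation "fun" :: (type, real_vector) real_vector
begin
definition scaleR_fun :: "real \<Rightarrow> ('a \<Rightarrow> 'b) \<Rightarrow> 'a \<Rightarrow> 'b"
  where "scaleR_fun r f = (\<lambda>x. r *\<^sub>R f x)"
instance
  by standard (simp_all add: scaleR_fun_def fun_eq_iff scaleR_add_right scaleR_add_left)
end

definition linear_between ::
    "'a::real_vector set \<Rightarrow> 'b::real_vector set \<Rightarrow> ('a \<Rightarrow> 'b) \<Rightarrow> bool"
  where "linear_between V W f \<longleftrightarrow>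
    subspace V \<and> subspace W \<and> f ` V \<subseteq> W \<and>
    (\<forall>u\<in>V. \<forall>v\<in>V. f (u + v) = f u + f v) \<and> (\<forall>r. \<forall>v\<in>V. f (r *\<^sub>R v) = r *\<^sub>R f v)"

section \<open>Smoothness in finite-dimensional normed spaces\<close>

text \<open>Only used for open \<open>S\<close> in a finite-dimensional space, where control of all
  iterated directional derivatives is the usual notion of class \<open>C\<^sup>n\<close>.\<close>

primrec C_on :: "nat \<Rightarrow> 'a::real_normed_vector set \<Rightarrow> ('a \<Rightarrow> 'b::real_normed_vector) \<Rightarrow> bool"
  where
    "C_on 0 S f \<longleftrightarrow> continuous_on S f"
  | "C_on (Suc n) S f \<longleftrightarrow> (\<forall>x\<in>S. f differentiable (at x)) \<and>
       (\<forall>v. C_on n S (\<lambda>x. frechet_derivative f (at x) v))"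

definition smooth_on :: "'a::real_normed_vector set \<Rightarrow> ('a \<Rightarrow> 'b::real_normed_vector) \<Rightarrow> bool"
  where "smooth_on S f \<longleftrightarrow> (\<forall>n. C_on n S f)"

section \<open>Smooth manifolds and smooth maps\<close>

text \<open>A chart is a coordinate domain together with a coordinate map; values of the map off its
  domain are irrelevant. The model space \<open>'e\<close> ranges over finite-dimensional normed spaces
  rather than the class \<^class>\<open>euclidean_space\<close>, as the latter excludes dimension 0
  (discrete Lie groups). A manifold is given by a type with its Hausdorff second countable
  topology and a smooth atlas, not necessarily maximal.\<close>

type_synonym ('m, 'e) chart = "'m set \<times> ('m \<Rightarrow> 'e)"

abbreviation cdom :: "('m, 'e) chart \<Rightarrow> 'm set" where "cdom \<equiv> fst"
abbreviation cmap :: "('m, 'e) chart \<Rightarrow> 'm \<Rightarrow> 'e" where "cmap \<equiv> snd"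

definition cimg :: "('m, 'e) chart \<Rightarrow> 'e set"
  where "cimg c = cmap c ` cdom c"

definition cinv :: "('m, 'e) chart \<Rightarrow> 'e \<Rightarrow> 'm"
  where "cinv c = inv_into (cdom c) (cmap c)"

definition charts_at :: "('m, 'e) chart set \<Rightarrow> 'm \<Rightarrow> ('m, 'e) chart set"
  where "charts_at A p = {c \<in> A. p \<in> cdom c}"

definition smooth_manifold ::
    "('m::{t2_space,second_countable_topology}, 'e::real_normed_vector) chart set \<Rightarrow> bool"
  where "smooth_manifold A \<longleftrightarrow>
    (\<exists>B. finite B \<and> span B = (UNIV :: 'e set)) \<and>
    (\<forall>c\<in>A. open (cdom c) \<and> open (cimg c) \<and>
       homeomorphism (cdom c) (cimg c) (cmap c) (cinv c)) \<and>
    (\<forall>p. charts_at A p \<noteq> {}) \<and>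
    (\<forall>c\<in>A. \<forall>d\<in>A. smooth_on (cmap c ` (cdom c \<inter> cdom d)) (cmap d \<circ> cinv c))"

definition chart_at :: "('m, 'e) chart set \<Rightarrow> 'm \<Rightarrow> ('m, 'e) chart"
  where "chart_at A p = (SOME c. c \<in> charts_at A p)"

definition product_atlas ::
    "('m, 'e) chart set \<Rightarrow> ('n, 'f) chart set \<Rightarrow> ('m \<times> 'n, 'e \<times> 'f) chart set"
  where "product_atlas A B =
    {(cdom c \<times> cdom d, map_prod (cmap c) (cmap d)) | c d. c \<in> A \<and> d \<in> B}"

definition smooth_map ::
    "('m::topological_space, 'e::real_normed_vector) chart set \<Rightarrow>
     ('n::topological_space, 'f::real_normed_vector) chart set \<Rightarrow> ('m \<Rightarrow> 'n) \<Rightarrow> bool"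
  where "smooth_map A B f \<longleftrightarrow> continuous_on UNIV f \<and>
    (\<forall>c\<in>A. \<forall>d\<in>B. smooth_on (cmap c ` (cdom c \<inter> f -` cdom d)) (cmap d \<circ> f \<circ> cinv c))"

definition smooth_fun ::
    "('m, 'e::real_normed_vector) chart set \<Rightarrow> ('m \<Rightarrow> real) \<Rightarrow> bool"
  where "smooth_fun A h \<longleftrightarrow> (\<forall>c\<in>A. smooth_on (cimg c) (h \<circ> cinv c))"

section \<open>Tangent and cotangent spaces\<close>

text \<open>A tangent vector at \<open>p\<close> is the family of its components in all charts around \<open>p\<close>,
  subject to the transformation law under change of charts (and set to 0 at
  charts that do not contain \<open>p\<close>).\<close>

type_synonym ('m, 'e) tvec = "('m, 'e) chart \<Rightarrow> 'e"
type_synonym ('m, 'e) covec = "('m, 'e) tvec \<Rightarrow> real"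
type_synonym ('m, 'e) bivec = "('m, 'e) covec \<Rightarrow> ('m, 'e) covec \<Rightarrow> real"
type_synonym ('m, 'e) trivec = "('m, 'e) covec \<Rightarrow> ('m, 'e) covec \<Rightarrow> ('m, 'e) covec \<Rightarrow> real"

definition tangent_space ::
    "('m, 'e::real_normed_vector) chart set \<Rightarrow> 'm \<Rightarrow> ('m, 'e) tvec set"
  where "tangent_space A p = {v.
    (\<forall>c\<in>charts_at A p. \<forall>d\<in>charts_at A p.
       v d = frechet_derivative (cmap d \<circ> cinv c) (at (cmap c p)) (v c)) \<and>
    (\<forall>d. d \<notin> charts_at A p \<longrightarrow> v d = 0)}"

definition cotangent_space ::
    "('m, 'e::real_normed_vector) chart set \<Rightarrow> 'm \<Rightarrow> ('m, 'e) covec set"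
  where "cotangent_space A p = {\<alpha>.
    linear_between (tangent_space A p) UNIV \<alpha> \<and> (\<forall>v. v \<notin> tangent_space A p \<longrightarrow> \<alpha> v = 0)}"

text \<open>The vector at \<open>p\<close> with component \<open>u\<close> in the chart \<open>c\<close>, and the covector at \<open>p\<close>
  represented by the linear form \<open>a\<close> in the chart \<open>c\<close>.\<close>

definition coord_vector ::
    "('m, 'e::real_normed_vector) chart set \<Rightarrow> ('m, 'e) chart \<Rightarrow> 'm \<Rightarrow> 'e \<Rightarrow> ('m, 'e) tvec"
  where "coord_vector A c p u = (\<lambda>d. if d \<in> charts_at A p
    then frechet_derivative (cmap d \<circ> cinv c) (at (cmap c p)) u else 0)"

definition coord_covector ::
    "('m, 'e::real_normed_vector) chart set \<Rightarrow> ('m, 'e) chart \<Rightarrow> 'm \<Rightarrow> ('e \<Rightarrow> real) \<Rightarrow> ('m, 'e) covec"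
  where "coord_covector A c p a = (\<lambda>v. if v \<in> tangent_space A p then a (v c) else 0)"

text \<open>By the chain rule the following two do not depend on the chart used at \<open>p\<close>.\<close>

definition tangent_map ::
    "('m, 'e::real_normed_vector) chart set \<Rightarrow> ('n, 'f::real_normed_vector) chart set \<Rightarrow>
     ('m \<Rightarrow> 'n) \<Rightarrow> 'm \<Rightarrow> ('m, 'e) tvec \<Rightarrow> ('n, 'f) tvec"
  where "tangent_map A B f p v = (let c = chart_at A p in
    (\<lambda>d. if d \<in> charts_at B (f p)
      then frechet_derivative (cmap d \<circ> f \<circ> cinv c) (at (cmap c p)) (v c) else 0))"

definition differential ::
    "('m, 'e::real_normed_vector) chart set \<Rightarrow> ('m \<Rightarrow> real) \<Rightarrow> 'm \<Rightarrow> ('m, 'e) covec"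
  where "differential A h p = (let c = chart_at A p in
    coord_covector A c p (frechet_derivative (h \<circ> cinv c) (at (cmap c p))))"

definition critical_point ::
    "('m, 'e::real_normed_vector) chart set \<Rightarrow> ('m \<Rightarrow> real) \<Rightarrow> 'm \<Rightarrow> bool"
  where "critical_point A h p \<longleftrightarrow> differential A h p = 0"

section \<open>Riemannian metrics\<close>

definition riemannian_metric ::
    "('m, 'e::real_normed_vector) chart set \<Rightarrow>
     ('m \<Rightarrow> ('m, 'e) tvec \<Rightarrow> ('m, 'e) tvec \<Rightarrow> real) \<Rightarrow> bool"
  where "riemannian_metric A g \<longleftrightarrow>
    (\<forall>p. (\<forall>u\<in>tangent_space A p. linear_between (tangent_space A p) UNIV (g p u)) \<and>
         (\<forall>u\<in>tangent_space A p. \<forall>v\<in>tangent_space A p. g p u v = g p v u) \<and>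
         (\<forall>u\<in>tangent_space A p. u \<noteq> 0 \<longrightarrow> g p u u > 0)) \<and>
    (\<forall>c\<in>A. \<forall>u v. smooth_on (cimg c)
       (\<lambda>x. g (cinv c x) (coord_vector A c (cinv c x) u) (coord_vector A c (cinv c x) v)))"

definition gradient ::
    "('m, 'e::real_normed_vector) chart set \<Rightarrow>
     ('m \<Rightarrow> ('m, 'e) tvec \<Rightarrow> ('m, 'e) tvec \<Rightarrow> real) \<Rightarrow> ('m \<Rightarrow> real) \<Rightarrow> 'm \<Rightarrow> ('m, 'e) tvec"
  where "gradient A g h p = (THE w. w \<in> tangent_space A p \<and>
    (\<forall>v\<in>tangent_space A p. g p w v = differential A h p v))"

section \<open>Bivector fields and Poisson structures\<close>

text \<open>The fibre \<open>\<Lambda>\<^sup>2 T\<^sub>p M\<close> consists of the skew-symmetric bilinear forms on the cotangent space.\<close>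

definition bivector_space ::
    "('m, 'e::real_normed_vector) chart set \<Rightarrow> 'm \<Rightarrow> ('m, 'e) bivec set"
  where "bivector_space A p = {b.
    (\<forall>\<alpha>\<in>cotangent_space A p. linear_between (cotangent_space A p) UNIV (b \<alpha>)) \<and>
    (\<forall>\<alpha>\<in>cotangent_space A p. \<forall>\<beta>\<in>cotangent_space A p. b \<alpha> \<beta> = - b \<beta> \<alpha>) \<and>
    (\<forall>\<alpha> \<beta>. \<alpha> \<notin> cotangent_space A p \<or> \<beta> \<notin> cotangent_space A p \<longrightarrow> b \<alpha> \<beta> = 0)}"

definition wedge ::
    "('m, 'e::real_normed_vector) chart set \<Rightarrow> 'm \<Rightarrow> ('m, 'e) tvec \<Rightarrow> ('m, 'e) tvec \<Rightarrow> ('m, 'e) bivec"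
  where "wedge A p Y X = (\<lambda>\<alpha> \<beta>.
    if \<alpha> \<in> cotangent_space A p \<and> \<beta> \<in> cotangent_space A p then \<alpha> Y * \<beta> X - \<alpha> X * \<beta> Y else 0)"

text \<open>\<open>b\<^sup>\<sharp>\<alpha> = b(\<alpha>, \<sqdot>)\<close>, with the bidual of the tangent space identified with the tangent space.\<close>

definition sharp ::
    "('m, 'e::real_normed_vector) chart set \<Rightarrow> 'm \<Rightarrow> ('m, 'e) bivec \<Rightarrow> ('m, 'e) covec \<Rightarrow> ('m, 'e) tvec"
  where "sharp A p b \<alpha> = (THE v. v \<in> tangent_space A p \<and>
    (\<forall>\<beta>\<in>cotangent_space A p. \<beta> v = b \<alpha> \<beta>))"

definition bivector_rank ::
    "('m, 'e::real_normed_vector) chart set \<Rightarrow> 'm \<Rightarrow> ('m, 'e) bivec \<Rightarrow> nat"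
  where "bivector_rank A p b = dim (sharp A p b ` cotangent_space A p)"

definition local_comp ::
    "('m, 'e::real_normed_vector) chart set \<Rightarrow> ('m, 'e) chart \<Rightarrow> ('m \<Rightarrow> ('m, 'e) bivec) \<Rightarrow>
     ('e \<Rightarrow> real) \<Rightarrow> ('e \<Rightarrow> real) \<Rightarrow> 'e \<Rightarrow> real"
  where "local_comp A c P a b = (\<lambda>x.
    P (cinv c x) (coord_covector A c (cinv c x) a) (coord_covector A c (cinv c x) b))"

definition bivector_field ::
    "('m, 'e::real_normed_vector) chart set \<Rightarrow> ('m \<Rightarrow> ('m, 'e) bivec) \<Rightarrow> bool"
  where "bivector_field A P \<longleftrightarrow> (\<forall>p. P p \<in> bivector_space A p) \<and>
    (\<forall>c\<in>A. \<forall>a b. linear a \<longrightarrow> linear b \<longrightarrow> smooth_on (cimg c) (local_comp A c P a b))"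

text \<open>The Schouten--Nijenhuis bracket of two bivector fields. Extending the Lie bracket by
  \<open>[X\<^sub>1 \<and> X\<^sub>2, Y\<^sub>1 \<and> Y\<^sub>2] = \<Sum>\<^sub>i\<^sub>j (-1)\<^bsup>i+j\<^esup> [X\<^sub>i, Y\<^sub>j] \<and> X\<^bsub>3-i\<^esub> \<and> Y\<^bsub>3-j\<^esub>\<close>
  and expanding \<open>P\<close> and \<open>Q\<close> in the coordinate bivectors \<open>\<partial>\<^sub>i \<and> \<partial>\<^sub>j\<close> of a chart gives the
  components
  \<open>[P,Q]\<^bsup>ijk\<^esup> = \<Sum>\<^sub>l P\<^bsup>il\<^esup> \<partial>\<^sub>l Q\<^bsup>jk\<^esup> + Q\<^bsup>il\<^esup> \<partial>\<^sub>l P\<^bsup>jk\<^esup> + (cyclic permutations of i, j, k)\<close>.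
  They are evaluated here in a chart around \<open>p\<close>: \<open>\<Sum>\<^sub>l P\<^bsup>il\<^esup> \<partial>\<^sub>l\<close> is the derivative in the direction
  \<open>P\<^sup>\<sharp>\<alpha>\<close>, and the covectors are extended with constant components in that chart. The
  result is a tensor, so it does not depend on the chart.\<close>

definition schouten_summand ::
    "('m, 'e::real_normed_vector) chart set \<Rightarrow> ('m \<Rightarrow> ('m, 'e) bivec) \<Rightarrow> ('m \<Rightarrow> ('m, 'e) bivec) \<Rightarrow>
     'm \<Rightarrow> ('m, 'e) trivec"
  where "schouten_summand A P Q p \<alpha> \<beta> \<gamma> = (let c = chart_at A p in
    frechet_derivative
      (local_comp A c Q (\<lambda>u. \<beta> (coord_vector A c p u)) (\<lambda>u. \<gamma> (coord_vector A c p u)))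
      (at (cmap c p)) (sharp A p (P p) \<alpha> c))"

definition schouten_bracket ::
    "('m, 'e::real_normed_vector) chart set \<Rightarrow> ('m \<Rightarrow> ('m, 'e) bivec) \<Rightarrow> ('m \<Rightarrow> ('m, 'e) bivec) \<Rightarrow>
     'm \<Rightarrow> ('m, 'e) trivec"
  where "schouten_bracket A P Q p = (\<lambda>\<alpha> \<beta> \<gamma>.
    if \<alpha> \<in> cotangent_space A p \<and> \<beta> \<in> cotangent_space A p \<and> \<gamma> \<in> cotangent_space A p
    then schouten_summand A P Q p \<alpha> \<beta> \<gamma> + schouten_summand A Q P p \<alpha> \<beta> \<gamma>
       + schouten_summand A P Q p \<beta> \<gamma> \<alpha> + schouten_summand A Q P p \<beta> \<gamma> \<alpha>
       + schouten_summand A P Q p \<gamma> \<alpha> \<beta> + schouten_summand A Q P p \<gamma> \<alpha> \<beta>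
    else 0)"

definition poisson_structure ::
    "('m, 'e::real_normed_vector) chart set \<Rightarrow> ('m \<Rightarrow> ('m, 'e) bivec) \<Rightarrow> bool"
  where "poisson_structure A P \<longleftrightarrow> bivector_field A P \<and> schouten_bracket A P P = 0"

section \<open>Lie groups and their actions\<close>

definition lie_group ::
    "('g::{t2_space,second_countable_topology}, 'f::real_normed_vector) chart set \<Rightarrow>
     ('g \<Rightarrow> 'g \<Rightarrow> 'g) \<Rightarrow> 'g \<Rightarrow> ('g \<Rightarrow> 'g) \<Rightarrow> bool"
  where "lie_group AG gmul e inverse_G \<longleftrightarrow> smooth_manifold AG \<and> Groups.group gmul e inverse_G \<and>
    smooth_map (product_atlas AG AG) AG (\<lambda>(a, b). gmul a b) \<and> smooth_map AG AG inverse_G"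

text \<open>The underlying vector space of the Lie algebra.\<close>

definition lie_algebra ::
    "('g, 'f::real_normed_vector) chart set \<Rightarrow> 'g \<Rightarrow> ('g, 'f) tvec set"
  where "lie_algebra AG e = tangent_space AG e"

definition smooth_action ::
    "('g::topological_space, 'f::real_normed_vector) chart set \<Rightarrow> ('g \<Rightarrow> 'g \<Rightarrow> 'g) \<Rightarrow> 'g \<Rightarrow>
     ('m::topological_space, 'e::real_normed_vector) chart set \<Rightarrow> ('g \<Rightarrow> 'm \<Rightarrow> 'm) \<Rightarrow> bool"
  where "smooth_action AG gmul e AM \<Phi> \<longleftrightarrow>
    (\<forall>x. \<Phi> e x = x) \<and> (\<forall>a b x. \<Phi> (gmul a b) x = \<Phi> a (\<Phi> b x)) \<and>
    smooth_map (product_atlas AG AM) AM (\<lambda>(a, x). \<Phi> a x)"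

definition proper_action :: "('g::topological_space \<Rightarrow> 'm::topological_space \<Rightarrow> 'm) \<Rightarrow> bool"
  where "proper_action \<Phi> \<longleftrightarrow> proper_map euclidean euclidean (\<lambda>(a, x). (\<Phi> a x, x))"

text \<open>\<open>\<xi>\<^sub>M(x) = T\<^sub>e(a \<mapsto> \<Phi>(a, x)) \<xi>\<close>, the velocity of \<open>exp (t\<xi>) x\<close> at \<open>t = 0\<close>.\<close>

definition infinitesimal_generator ::
    "('g, 'f::real_normed_vector) chart set \<Rightarrow> 'g \<Rightarrow> ('m, 'e::real_normed_vector) chart set \<Rightarrow>
     ('g \<Rightarrow> 'm \<Rightarrow> 'm) \<Rightarrow> ('g, 'f) tvec \<Rightarrow> 'm \<Rightarrow> ('m, 'e) tvec"
  where "infinitesimal_generator AG e AM \<Phi> \<xi> x = tangent_map AG AM (\<lambda>a. \<Phi> a x) e \<xi>"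

definition invariant_fun :: "('g \<Rightarrow> 'm \<Rightarrow> 'm) \<Rightarrow> ('m \<Rightarrow> real) \<Rightarrow> bool"
  where "invariant_fun \<Phi> h \<longleftrightarrow> (\<forall>a x. h (\<Phi> a x) = h x)"

definition invariant_metric ::
    "('m, 'e::real_normed_vector) chart set \<Rightarrow> ('g \<Rightarrow> 'm \<Rightarrow> 'm) \<Rightarrow>
     ('m \<Rightarrow> ('m, 'e) tvec \<Rightarrow> ('m, 'e) tvec \<Rightarrow> real) \<Rightarrow> bool"
  where "invariant_metric AM \<Phi> g \<longleftrightarrow>
    (\<forall>a x. \<forall>u\<in>tangent_space AM x. \<forall>v\<in>tangent_space AM x.
       g (\<Phi> a x) (tangent_map AM AM (\<Phi> a) x u) (tangent_map AM AM (\<Phi> a) x v) = g x u v)"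

definition pi_xi ::
    "('g, 'f::real_normed_vector) chart set \<Rightarrow> 'g \<Rightarrow> ('m, 'e::real_normed_vector) chart set \<Rightarrow>
     ('g \<Rightarrow> 'm \<Rightarrow> 'm) \<Rightarrow> ('m \<Rightarrow> ('m, 'e) tvec \<Rightarrow> ('m, 'e) tvec \<Rightarrow> real) \<Rightarrow> ('m \<Rightarrow> real) \<Rightarrow>
     ('g, 'f) tvec \<Rightarrow> 'm \<Rightarrow> ('m, 'e) bivec"
  where "pi_xi AG e AM \<Phi> g h \<xi> x =
    wedge AM x
      ((1 / g x (gradient AM g h x) (gradient AM g h x)) *\<^sub>R gradient AM g h x)
      (infinitesimal_generator AG e AM \<Phi> \<xi> x)"

end

theory Submission
  imports Defs
begin

text \<open>Write \<open>Y = \<nabla>h / g(\<nabla>h, \<nabla>h)\<close> and \<open>X = \<xi>\<^sub>M\<close>. Since \<open>h\<close> and \<open>g\<close> are invariant, so is \<open>Y\<close>, hence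
  \<open>[Y, X] = 0\<close>, and the Schouten bracket of \<open>Y \<and> X\<close> with itself, a multiple of \<open>[Y, X] \<and> Y \<and> X\<close>, vanishes.
  The rank is at most two because the image of \<open>(Y \<and> X)\<^sup>\<sharp>\<close> lies in the span of \<open>Y\<close> and \<open>X\<close>; finally
  \<open>dh(Y) = 1\<close> and \<open>dh(X) = 0\<close> give \<open>(Y \<and> X)\<^sup>\<sharp> dh = X\<close>. The space of Poisson structures is the image of
  the Lie algebra under \<open>\<xi> \<mapsto> Y \<and> \<xi>\<^sub>M\<close>.\<close>

section \<open>Smooth functions on normed spaces\<close>

text \<open>Poisson structures do not form a vector space, as \<open>[P,P] = 0\<close> is a
  quadratic condition. The image of the Lie algebra works because its members share the factor
  \<open>Y\<close>, so sums and multiples keep the form \<open>Y \<and> \<xi>\<^sub>M\<close>. Two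
  obstacles shape the proof. The gradient is described pointwise by a unique-choice operator, so its
  existence and smoothness require solving the Gram equations smoothly in a chart. The model spaces
  are normed spaces with a finite spanning set and come with no inner product or basis, so
  boundedness of linear maps has to be derived, and derivatives are handled as maps rather than
  matrices. Commutation is checked only in the chart that \<open>chart_at\<close> selects, the one
  in which the Schouten bracket is evaluated. There the action is a single smooth function of two
  variables, the generator is its partial derivative at the neutral element, and
  \<open>[Y, X] = 0\<close> is the symmetry of a mixed second derivative.\<close>

abbreviation D :: "('a::real_normed_vector \<Rightarrow> 'b::real_normed_vector) \<Rightarrow> 'a \<Rightarrow> 'a \<Rightarrow> 'b"
  where "D f x \<equiv> frechet_derivative f (at x)"

lemma D_eqI: "(f has_derivative f') (at x) \<Longrightarrow> D f x = f'"
  by (rule frechet_derivative_at[symmetric])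

lemma has_derivative_D: "f differentiable (at x) \<Longrightarrow> (f has_derivative D f x) (at x)"
  by (simp add: frechet_derivative_works)

text \<open>\<open>frechet_derivative\<close> is a choice among the maps satisfying
  \<open>has_derivative\<close>. The two functions agree near \<open>x\<close>, so the predicates
  coincide and so do the choices, even where no derivative exists.\<close>

lemma D_cong:
  assumes "open S" "x \<in> S" "\<And>y. y \<in> S \<Longrightarrow> f y = g y"
  shows "D f x = D g x"
proof -
  have "(f has_derivative f') (at x) \<longleftrightarrow> (g has_derivative f') (at x)" for f'
    by (metis assms has_derivative_transform_within_open)
  then show ?thesis
    by (simp add: frechet_derivative_def)
qed

lemma differentiable_cong_open:
  assumes "open S" "x \<in> S" "\<And>y. y \<in> S \<Longrightarrow> f y = g y"
  shows "f differentiable (at x) \<longleftrightarrow> g differentiable (at x)"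
  by (metis assms differentiable_def has_derivative_transform_within_open)

section \<open>Closure properties of the classes \<open>C_on\<close>\<close>

lemma C_on_cong:
  assumes "open S" "\<And>x. x \<in> S \<Longrightarrow> f x = g x"
  shows "C_on n S f \<longleftrightarrow> C_on n S g"
  using assms(2)
proof (induction n arbitrary: f g)
  case 0
  then show ?case by (simp cong: continuous_on_cong)
next
  case (Suc n)
  have "D f x = D g x" if "x \<in> S" for x
    using D_cong[OF assms(1) that Suc.prems] .
  then have "C_on n S (\<lambda>x. D f x v) \<longleftrightarrow> C_on n S (\<lambda>x. D g x v)" for v
    by (intro Suc.IH) simp
  moreover have "f differentiable (at x) \<longleftrightarrow> g differentiable (at x)" if "x \<in> S" for x
    using differentiable_cong_open[OF assms(1) that Suc.prems] .
  ultimately show ?case by simp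
qed

text \<open>Lets the derivative be given by a formula such as the product rule, so that the
  inductions below apply their hypothesis to that formula.\<close>

lemma C_on_SucI:
  assumes "open S" "\<And>x. x \<in> S \<Longrightarrow> (f has_derivative f' x) (at x)" "\<And>v. C_on n S (\<lambda>x. f' x v)"
  shows "C_on (Suc n) S f"
proof -
  have "C_on n S (\<lambda>x. D f x v)" for v
    using C_on_cong[OF assms(1), of "\<lambda>x. D f x v" "\<lambda>x. f' x v"] D_eqI[OF assms(2)] assms(3)
    by simp
  then show ?thesis
    using assms(2) by (auto simp: differentiable_def)
qed

lemma C_on_SucD: "C_on (Suc n) S f \<Longrightarrow> C_on n S f"
proof (induction n arbitrary: f)
  case 0
  then show ?case
    by (auto intro!: continuous_at_imp_continuous_on differentiable_imp_continuous_within)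
next
  case (Suc n)
  then show ?case by (metis C_on.simps(2))
qed

lemma C_on_const: "C_on n S (\<lambda>x. c)"
  by (induction n arbitrary: c) auto

lemma C_on_add:
  assumes "open S" "C_on n S f" "C_on n S g"
  shows "C_on n S (\<lambda>x. f x + g x)"
  using assms(2,3)
proof (induction n arbitrary: f g)
  case 0
  then show ?case by (auto intro: continuous_intros)
next
  case (Suc n)
  then show ?case
    by (intro C_on_SucI[OF assms(1), where f' = "\<lambda>x v. D f x v + D g x v"])
      (auto intro!: has_derivative_add has_derivative_D)
qed

lemma C_on_bounded_linear:
  assumes "open S" "bounded_linear L" "C_on n S f"
  shows "C_on n S (\<lambda>x. L (f x))"
  using assms(3)
proof (induction n arbitrary: f)
  case 0
  then show ?case using assms(2) by (auto intro: bounded_linear.continuous_on)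
next
  case (Suc n)
  then show ?case
    by (intro C_on_SucI[OF assms(1), where f' = "\<lambda>x v. L (D f x v)"])
      (auto intro!: bounded_linear.has_derivative[OF assms(2)] has_derivative_D)
qed

lemma C_on_bilinear:
  assumes "open S" "bounded_bilinear B" "C_on n S f" "C_on n S g"
  shows "C_on n S (\<lambda>x. B (f x) (g x))"
  using assms(3,4)
proof (induction n arbitrary: f g)
  case 0
  then show ?case using assms(2) by (auto intro: bounded_bilinear.continuous_on)
next
  case (Suc n)
  \<comment> \<open>The product rule keeps undifferentiated factors, so \<open>f\<close> and
    \<open>g\<close> enter one order lower as well.\<close>
  have fg: "C_on n S f" "C_on n S g"
    using Suc.prems C_on_SucD by blast+
  show ?case
  proof (intro C_on_SucI[OF assms(1), where f' = "\<lambda>x v. B (f x) (D g x v) + B (D f x v) (g x)"])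
    fix x assume "x \<in> S"
    then show "((\<lambda>x. B (f x) (g x)) has_derivative (\<lambda>v. B (f x) (D g x v) + B (D f x v) (g x))) (at x)"
      using Suc.prems by (auto intro!: bounded_bilinear.FDERIV[OF assms(2)] has_derivative_D)
  qed (use Suc fg in \<open>auto intro!: C_on_add[OF assms(1)]\<close>)
qed

text \<open>The derivative of the reciprocal contains the reciprocal again, which the induction
  hypothesis covers at order \<open>n\<close>.\<close>

lemma C_on_inverse:
  fixes f :: "'a::real_normed_vector \<Rightarrow> real"
  assumes "open S" "C_on n S f" "\<And>x. x \<in> S \<Longrightarrow> f x \<noteq> 0"
  shows "C_on n S (\<lambda>x. inverse (f x))"
  using assms(2)
proof (induction n)
  case 0
  then show ?case using assms(3) by (auto intro: continuous_intros)
next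
  case (Suc n)
  have i: "C_on n S (\<lambda>x. inverse (f x))"
    using Suc C_on_SucD by blast
  show ?case
  proof (intro C_on_SucI[OF assms(1), where f' = "\<lambda>x v. - (inverse (f x) * D f x v * inverse (f x))"])
    fix x assume "x \<in> S"
    then show "((\<lambda>x. inverse (f x)) has_derivative (\<lambda>v. - (inverse (f x) * D f x v * inverse (f x)))) (at x)"
      using Suc.prems assms(3) by (auto intro!: Deriv.has_derivative_inverse has_derivative_D)
  next
    fix v
    have "C_on n S (\<lambda>x. D f x v)" using Suc.prems by simp
    then show "C_on n S (\<lambda>x. - (inverse (f x) * D f x v * inverse (f x)))"
      by (intro C_on_bounded_linear[OF assms(1) bounded_linear_minus[OF bounded_linear_ident]]
          C_on_bilinear[OF assms(1) bounded_bilinear_mult] i)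
  qed
qed

text \<open>Serves to freeze one variable of a function of two variables. The inner map is affine,
  so its derivative contributes only the constant direction \<open>L v\<close> and the induction
  closes.\<close>

lemma C_on_affine:
  assumes "open S" "open T" "bounded_linear L" "\<And>y. y \<in> T \<Longrightarrow> c + L y \<in> S" "C_on n S f"
  shows "C_on n T (\<lambda>y. f (c + L y))"
  using assms(5)
proof (induction n arbitrary: f)
  case 0
  have "continuous_on T (\<lambda>y. c + L y)"
    using assms(3) by (intro continuous_intros linear_continuous_on)
  with 0 show ?case
    using assms(4) by (auto intro: continuous_on_compose2[of S f])
next
  case (Suc n)
  show ?case
  proof (intro C_on_SucI[OF assms(2), where f' = "\<lambda>y v. D f (c + L y) (L v)"])
    fix y assume "y \<in> T"
    then have "(f has_derivative D f (c + L y)) (at (c + L y))"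
      using Suc.prems assms(4) by (auto intro: has_derivative_D)
    moreover have "((\<lambda>y. c + L y) has_derivative L) (at y)"
      using bounded_linear_imp_has_derivative[OF assms(3)] by (auto intro!: derivative_eq_intros)
    ultimately show "((\<lambda>y. f (c + L y)) has_derivative (\<lambda>v. D f (c + L y) (L v))) (at y)"
      using has_derivative_compose by fastforce
  qed (use Suc in auto)
qed

lemma smooth_on_cong:
  "open S \<Longrightarrow> (\<And>x. x \<in> S \<Longrightarrow> f x = g x) \<Longrightarrow> smooth_on S f \<longleftrightarrow> smooth_on S g"
  using C_on_cong unfolding smooth_on_def by blast

lemma smooth_on_const: "smooth_on S (\<lambda>x. c)"
  by (simp add: smooth_on_def C_on_const)

lemma smooth_on_add:
  "open S \<Longrightarrow> smooth_on S f \<Longrightarrow> smooth_on S g \<Longrightarrow> smooth_on S (\<lambda>x. f x + g x)"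
  by (simp add: smooth_on_def C_on_add)

lemma smooth_on_bounded_linear:
  "open S \<Longrightarrow> bounded_linear L \<Longrightarrow> smooth_on S f \<Longrightarrow> smooth_on S (\<lambda>x. L (f x))"
  by (simp add: smooth_on_def C_on_bounded_linear)

lemma smooth_on_bilinear:
  "open S \<Longrightarrow> bounded_bilinear B \<Longrightarrow> smooth_on S f \<Longrightarrow> smooth_on S g \<Longrightarrow> smooth_on S (\<lambda>x. B (f x) (g x))"
  by (simp add: smooth_on_def C_on_bilinear)

lemmas smooth_on_mult = smooth_on_bilinear[OF _ bounded_bilinear_mult]
lemmas smooth_on_scaleR = smooth_on_bilinear[OF _ bounded_bilinear_scaleR]

lemma smooth_on_diff:
  "open S \<Longrightarrow> smooth_on S f \<Longrightarrow> smooth_on S g \<Longrightarrow> smooth_on S (\<lambda>x. f x - g x)"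
  using smooth_on_add[of S f "\<lambda>x. - g x"]
    smooth_on_bounded_linear[of S uminus g, OF _ bounded_linear_minus[OF bounded_linear_ident]] by simp

lemma smooth_on_sum:
  assumes "open S" "\<And>i. i \<in> I \<Longrightarrow> smooth_on S (f i)"
  shows "smooth_on S (\<lambda>x. \<Sum>i\<in>I. f i x)"
  using assms(2)
  by (induction I rule: infinite_finite_induct) (auto intro: smooth_on_const smooth_on_add[OF assms(1)])

lemma smooth_on_divide:
  fixes f :: "'a::real_normed_vector \<Rightarrow> real"
  assumes "open S" "smooth_on S f" "smooth_on S g" "\<And>x. x \<in> S \<Longrightarrow> g x \<noteq> 0"
  shows "smooth_on S (\<lambda>x. f x / g x)"
  using assms smooth_on_mult[of S f "\<lambda>x. inverse (g x)"]
  by (simp add: divide_inverse smooth_on_def C_on_inverse)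

lemma smooth_on_affine:
  "open S \<Longrightarrow> open T \<Longrightarrow> bounded_linear L \<Longrightarrow> (\<And>y. y \<in> T \<Longrightarrow> c + L y \<in> S) \<Longrightarrow> smooth_on S f \<Longrightarrow>
    smooth_on T (\<lambda>y. f (c + L y))"
  by (simp add: smooth_on_def C_on_affine)

lemma smooth_on_imp_differentiable: "smooth_on S f \<Longrightarrow> x \<in> S \<Longrightarrow> f differentiable (at x)"
  unfolding smooth_on_def by (metis C_on.simps(2))

lemma smooth_on_D: "smooth_on S f \<Longrightarrow> smooth_on S (\<lambda>x. D f x v)"
  unfolding smooth_on_def by (metis C_on.simps(2))

section \<open>Symmetry of second derivatives\<close>

text \<open>Differencing in direction \<open>v\<close> leaves a function of the parameter along
  \<open>u\<close>. The mean value inequality bounds its increment by values of \<open>?F\<close>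
  near \<open>z\<close>, and these are controlled by the differentiability of \<open>?F\<close> at
  the single point \<open>z\<close>.\<close>

lemma second_difference_quotient:
  fixes f :: "'a::real_normed_vector \<Rightarrow> 'b::real_normed_vector"
  assumes W: "open W" "z \<in> W" and f: "\<And>x. x \<in> W \<Longrightarrow> f differentiable (at x)"
    and fu: "(\<lambda>x. D f x u) differentiable (at z)" and "\<epsilon> > 0"
  shows "\<exists>d>0. \<forall>s. 0 < s \<and> s < d \<longrightarrow>
    norm ((f (z + s *\<^sub>R u + s *\<^sub>R v) - f (z + s *\<^sub>R u) - f (z + s *\<^sub>R v) + f z)
      - (s * s) *\<^sub>R D (\<lambda>x. D f x u) z v) \<le> \<epsilon> * (s * s)"
proof -
  let ?F = "\<lambda>x. D f x u"
  define A where "A = D ?F z"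
  have A: "(?F has_derivative A) (at z)" unfolding A_def using fu by (rule has_derivative_D)
  then have lA: "linear A" by (rule has_derivative_linear)
  \<comment> \<open>\<open>s * M\<close> bounds \<open>norm (r *\<^sub>R u + q *\<^sub>R v)\<close>
    for \<open>r\<close>, \<open>q\<close> between 0 and \<open>s\<close>; the summand 1 keeps
    \<open>M\<close> positive when \<open>u\<close> and \<open>v\<close> vanish.\<close>
  define M where "M = norm u + norm v + 1"
  have M: "M > 0" by (simp add: M_def add_nonneg_pos)
  \<comment> \<open>Two remainders \<open>\<delta> * (s * M)\<close> over an interval of length
    \<open>s\<close> add up to \<open>\<epsilon> * (s * s)\<close>.\<close>
  define \<delta> where "\<delta> = \<epsilon> / (2 * M)"
  have "\<delta> > 0" using M \<open>\<epsilon> > 0\<close> by (simp add: \<delta>_def)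
  then obtain d1 where d1: "d1 > 0"
    "\<And>y. norm (y - z) < d1 \<Longrightarrow> norm (?F y - ?F z - A (y - z)) \<le> \<delta> * norm (y - z)"
    using A unfolding has_derivative_at_alt by blast
  obtain d2 where d2: "d2 > 0" "ball z d2 \<subseteq> W" using W open_contains_ball by blast
  define d where "d = min d1 d2 / M"
  have "norm ((f (z + s *\<^sub>R u + s *\<^sub>R v) - f (z + s *\<^sub>R u) - f (z + s *\<^sub>R v) + f z)
      - (s * s) *\<^sub>R A v) \<le> \<epsilon> * (s * s)" if s: "0 < s" "s < d" for s
  proof -
    have sM: "s * M < d1" "s * M < d2"
      using s M by (auto simp: d_def field_simps)
    have small: "norm (r *\<^sub>R u + q *\<^sub>R v) \<le> s * M" if "0 \<le> r" "r \<le> s" "0 \<le> q" "q \<le> s" for r q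
    proof -
      have "norm (r *\<^sub>R u + q *\<^sub>R v) \<le> r * norm u + q * norm v"
        using norm_triangle_ineq[of "r *\<^sub>R u" "q *\<^sub>R v"] that by simp
      also have "\<dots> \<le> s * norm u + s * norm v"
        using that by (intro add_mono mult_right_mono) auto
      also have "\<dots> \<le> s * M" using s by (simp add: M_def algebra_simps)
      finally show ?thesis .
    qed
    have inW: "z + (r *\<^sub>R u + q *\<^sub>R v) \<in> W" if "0 \<le> r" "r \<le> s" "0 \<le> q" "q \<le> s" for r q
      using d2 small[OF that] sM by (auto simp: dist_norm subset_iff mem_ball norm_minus_commute)
    have est: "norm (?F (z + (r *\<^sub>R u + q *\<^sub>R v)) - ?F z - A (r *\<^sub>R u + q *\<^sub>R v)) \<le> \<delta> * (s * M)"
      if "0 \<le> r" "r \<le> s" "0 \<le> q" "q \<le> s" for r q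
    proof -
      have "norm (?F (z + (r *\<^sub>R u + q *\<^sub>R v)) - ?F z - A (r *\<^sub>R u + q *\<^sub>R v))
          \<le> \<delta> * norm (r *\<^sub>R u + q *\<^sub>R v)"
        using d1(2)[of "z + (r *\<^sub>R u + q *\<^sub>R v)"] small[OF that] sM by simp
      also have "\<dots> \<le> \<delta> * (s * M)" using small[OF that] \<open>\<delta> > 0\<close> by simp
      finally show ?thesis .
    qed
    \<comment> \<open>The difference in direction \<open>v\<close> minus its expected linear part,
      so that \<open>g s - g 0\<close> is the quantity to be bounded. The term
      \<open>0 *\<^sub>R v\<close> gives both points the shape used in \<open>fd\<close> and
      \<open>est\<close>.\<close>
    define g where "g r = f (z + (r *\<^sub>R u + s *\<^sub>R v)) - f (z + (r *\<^sub>R u + 0 *\<^sub>R v)) - (r * s) *\<^sub>R A v" for r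
    define g' where "g' r = ?F (z + (r *\<^sub>R u + s *\<^sub>R v)) - ?F (z + (r *\<^sub>R u + 0 *\<^sub>R v)) - s *\<^sub>R A v" for r
    have "norm (g s - g 0) \<le> (2 * \<delta> * s * M) * norm (s - 0)"
    proof (rule differentiable_bound[of "{0..s}" g "\<lambda>r h. h *\<^sub>R g' r"])
      fix r assume r: "r \<in> {0..s}"
      have fd: "((\<lambda>r. f (z + (r *\<^sub>R u + q *\<^sub>R v))) has_derivative
          (\<lambda>h. h *\<^sub>R ?F (z + (r *\<^sub>R u + q *\<^sub>R v)))) (at r)"
        if q: "0 \<le> q" "q \<le> s" for q
      proof -
        have df: "(f has_derivative D f (z + (r *\<^sub>R u + q *\<^sub>R v))) (at (z + (r *\<^sub>R u + q *\<^sub>R v)))"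
          using f inW r q by (auto intro!: has_derivative_D)
        have "((\<lambda>r. z + (r *\<^sub>R u + q *\<^sub>R v)) has_derivative (\<lambda>h. h *\<^sub>R u)) (at r)"
          by (auto intro!: derivative_eq_intros)
        from has_derivative_compose[OF this df] show ?thesis
          by (simp add: linear_cmul[OF has_derivative_linear[OF df]])
      qed
      have "(g has_derivative (\<lambda>h. h *\<^sub>R g' r)) (at r)"
        unfolding g_def g'_def using s fd[of s] fd[of 0]
        by (auto intro!: derivative_eq_intros simp: algebra_simps)
      then show "(g has_derivative (\<lambda>h. h *\<^sub>R g' r)) (at r within {0..s})"
        by (rule has_derivative_at_withinI)
      \<comment> \<open>The two values of \<open>A\<close> differ by exactly
        \<open>s *\<^sub>R A v\<close>, so \<open>g' r\<close> is a difference of two first-order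
        remainders at \<open>z\<close>.\<close>
      have "g' r = (?F (z + (r *\<^sub>R u + s *\<^sub>R v)) - ?F z - A (r *\<^sub>R u + s *\<^sub>R v))
        - (?F (z + (r *\<^sub>R u + 0 *\<^sub>R v)) - ?F z - A (r *\<^sub>R u + 0 *\<^sub>R v))"
        unfolding g'_def by (simp add: linear_add[OF lA] linear_cmul[OF lA])
      also have "norm \<dots> \<le> \<delta> * (s * M) + \<delta> * (s * M)"
        by (rule norm_triangle_le_diff, rule add_mono) (use est[of r s] est[of r 0] r s in auto)
      finally have "norm (g' r) \<le> 2 * \<delta> * s * M" by (simp add: mult_ac)
      then show "onorm (\<lambda>h. h *\<^sub>R g' r) \<le> 2 * \<delta> * s * M"
        by (intro onorm_le) (simp add: mult.commute mult_left_mono)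
    qed (use s in auto)
    also have "\<dots> = \<epsilon> * (s * s)" using M s by (simp add: \<delta>_def field_simps)
    finally show ?thesis by (simp add: g_def algebra_simps)
  qed
  moreover have "d > 0" using d1 d2 M by (simp add: d_def)
  ultimately show ?thesis unfolding A_def by blast
qed

text \<open>The second difference is symmetric in \<open>u\<close> and \<open>v\<close>; divided by
  \<open>s * s\<close> it therefore tends to both iterated derivatives.\<close>

lemma second_derivative_symmetric:
  fixes f :: "'a::real_normed_vector \<Rightarrow> 'b::real_normed_vector"
  assumes W: "open W" "z \<in> W" and f: "\<And>x. x \<in> W \<Longrightarrow> f differentiable (at x)"
    and fu: "(\<lambda>x. D f x u) differentiable (at z)" and fv: "(\<lambda>x. D f x v) differentiable (at z)"
  shows "D (\<lambda>x. D f x u) z v = D (\<lambda>x. D f x v) z u" (is "?a = ?b")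
proof (rule ccontr)
  assume "?a \<noteq> ?b"
  then have n: "norm (?a - ?b) > 0" by simp
  \<comment> \<open>A third of the gap: the two errors together amount to at most two thirds of
    it.\<close>
  define \<epsilon> where "\<epsilon> = norm (?a - ?b) / 3"
  have "\<epsilon> > 0" using n by (simp add: \<epsilon>_def)
  define \<Delta> where "\<Delta> s = f (z + s *\<^sub>R u + s *\<^sub>R v) - f (z + s *\<^sub>R u) - f (z + s *\<^sub>R v) + f z" for s
  obtain d1 where d1: "d1 > 0" "\<And>s. 0 < s \<Longrightarrow> s < d1 \<Longrightarrow> norm (\<Delta> s - (s * s) *\<^sub>R ?a) \<le> \<epsilon> * (s * s)"
    using second_difference_quotient[OF W f fu \<open>\<epsilon> > 0\<close>, of v] unfolding \<Delta>_def by blast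
  have sw: "f (z + s *\<^sub>R v + s *\<^sub>R u) - f (z + s *\<^sub>R v) - f (z + s *\<^sub>R u) + f z = \<Delta> s" for s
    by (simp add: \<Delta>_def algebra_simps)
  obtain d2 where d2: "d2 > 0" "\<And>s. 0 < s \<Longrightarrow> s < d2 \<Longrightarrow> norm (\<Delta> s - (s * s) *\<^sub>R ?b) \<le> \<epsilon> * (s * s)"
    using second_difference_quotient[OF W f fv \<open>\<epsilon> > 0\<close>, of u] unfolding sw by blast
  define s where "s = min d1 d2 / 2"
  have s: "0 < s" "s < d1" "s < d2" using d1(1) d2(1) by (auto simp: s_def)
  have "(s * s) * norm (?a - ?b) = norm ((\<Delta> s - (s * s) *\<^sub>R ?b) - (\<Delta> s - (s * s) *\<^sub>R ?a))"
  proof -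
    have "(\<Delta> s - (s * s) *\<^sub>R ?b) - (\<Delta> s - (s * s) *\<^sub>R ?a) = (s * s) *\<^sub>R (?a - ?b)"
      by (simp add: scaleR_diff_right)
    then show ?thesis by simp
  qed
  also have "\<dots> \<le> \<epsilon> * (s * s) + \<epsilon> * (s * s)"
    by (rule norm_triangle_le_diff, rule add_mono) (use d1(2)[of s] d2(2)[of s] s in auto)
  finally have "(s * s) * norm (?a - ?b) \<le> (s * s) * (2 * \<epsilon>)" by (simp add: algebra_simps)
  then have "norm (?a - ?b) \<le> 2 * \<epsilon>" using s by simp
  then show False using n by (simp add: \<epsilon>_def)
qed

section \<open>Linear maps on finite-dimensional normed spaces\<close>

text \<open>Compactness of the unit sphere of the coordinate sum norm. Coordinates are functions on
  the whole type, so the sphere is cut out of the cube \<open>[-1,1]^'a\<close>, compact by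
  Tychonoff; the minimum of the norm on it is positive by independence.\<close>

lemma independent_norm_bound:
  fixes B :: "'a::real_normed_vector set"
  assumes B: "finite B" "independent B"
  shows "\<exists>C>0. \<forall>u. C * (\<Sum>b\<in>B. \<bar>u b\<bar>) \<le> norm (\<Sum>b\<in>B. u b *\<^sub>R b)"
proof (cases "B = {}")
  case True
  then show ?thesis by (auto intro: exI[of _ 1])
next
  case False
  define T :: "('a \<Rightarrow> real) set" where "T = Pi UNIV (\<lambda>_. {-1..1}) \<inter> {u. (\<Sum>b\<in>B. \<bar>u b\<bar>) = 1}"
  have "compactin (product_topology (\<lambda>_. euclidean) UNIV) (PiE UNIV (\<lambda>_::'a. {-1..1::real}))"
    by (subst compactin_PiE) auto
  then have "compact (Pi UNIV (\<lambda>_::'a. {-1..1::real}))"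
    by (simp add: euclidean_product_topology PiE_UNIV_domain)
  moreover have "closed {u::'a \<Rightarrow> real. (\<Sum>b\<in>B. \<bar>u b\<bar>) = 1}"
    by (intro closed_Collect_eq continuous_intros) auto
  ultimately have "compact T" unfolding T_def by (rule compact_Int_closed)
  moreover have "continuous_on T (\<lambda>u. norm (\<Sum>b\<in>B. u b *\<^sub>R b))"
    by (intro continuous_intros continuous_on_subset[OF continuous_on_product_coordinates]) auto
  moreover have "T \<noteq> {}"
  proof -
    obtain b where "b \<in> B" using False by blast
    then have "(\<lambda>x. if x = b then 1 else 0) \<in> T" using B(1) by (auto simp: T_def if_distrib cong: if_cong)
    then show ?thesis by blast
  qed
  ultimately have "\<exists>u0\<in>T. \<forall>u\<in>T. norm (\<Sum>b\<in>B. u0 b *\<^sub>R b) \<le> norm (\<Sum>b\<in>B. u b *\<^sub>R b)"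
    by (intro continuous_attains_inf)
  then obtain u0 where u0: "u0 \<in> T"
    "\<forall>u\<in>T. norm (\<Sum>b\<in>B. u0 b *\<^sub>R b) \<le> norm (\<Sum>b\<in>B. u b *\<^sub>R b)"
    by (elim bexE) (rule that)
  define C where "C = norm (\<Sum>b\<in>B. u0 b *\<^sub>R b)"
  have "C \<noteq> 0"
  proof
    assume "C = 0"
    then have "(\<Sum>b\<in>B. u0 b *\<^sub>R b) = 0" by (simp add: C_def)
    then have "\<forall>b\<in>B. u0 b = 0" by (intro ballI independentD[OF B(2,1) subset_refl])
    then show False using u0(1) by (simp add: T_def)
  qed
  moreover have "C \<ge> 0" by (simp add: C_def)
  moreover have "C * (\<Sum>b\<in>B. \<bar>u b\<bar>) \<le> norm (\<Sum>b\<in>B. u b *\<^sub>R b)" for u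
  proof (cases "(\<Sum>b\<in>B. \<bar>u b\<bar>) = 0")
    case True
    then show ?thesis by simp
  next
    case False
    define t where "t = (\<Sum>b\<in>B. \<bar>u b\<bar>)"
    have t: "t > 0" using False by (simp add: t_def less_le sum_nonneg)
    \<comment> \<open>Zero outside \<open>B\<close>, so that all coordinates lie in the
      cube.\<close>
    define w where "w b = (if b \<in> B then u b / t else 0)" for b
    have "\<bar>u b\<bar> \<le> t" if "b \<in> B" for b
      unfolding t_def using that B(1) by (intro member_le_sum) auto
    then have "\<bar>w b\<bar> \<le> 1" for b using t by (simp add: w_def)
    moreover have "(\<Sum>b\<in>B. \<bar>w b\<bar>) = 1"
      using t by (simp add: w_def t_def[symmetric] sum_divide_distrib[symmetric])
    ultimately have "w \<in> T" by (simp add: T_def abs_le_iff minus_le_iff)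
    then have "C \<le> norm (\<Sum>b\<in>B. w b *\<^sub>R b)" unfolding C_def by (rule u0(2)[rule_format])
    also have "(\<Sum>b\<in>B. w b *\<^sub>R b) = (1 / t) *\<^sub>R (\<Sum>b\<in>B. u b *\<^sub>R b)"
      by (simp add: w_def scaleR_sum_right)
    also have "norm \<dots> = norm (\<Sum>b\<in>B. u b *\<^sub>R b) / t" using t by simp
    finally show ?thesis using t by (simp add: t_def[symmetric] field_simps)
  qed
  ultimately show ?thesis by (intro exI[of _ C]) simp
qed

lemma finite_dim_basis:
  assumes "\<exists>B::'a::real_vector set. finite B \<and> span B = UNIV"
  obtains B :: "'a::real_vector set" where "finite B" "independent B" "span B = UNIV"
proof -
  obtain B0 :: "'a set" where "finite B0" "span B0 = UNIV" using assms by blast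
  obtain B where "B \<subseteq> B0" and ind: "independent B" and "B0 \<subseteq> span B"
    using maximal_independent_subset[of B0] by blast
  have "finite B" using \<open>B \<subseteq> B0\<close> \<open>finite B0\<close> by (rule finite_subset)
  moreover have "span B = UNIV"
    using span_mono[OF \<open>B0 \<subseteq> span B\<close>] \<open>span B0 = UNIV\<close> by (simp add: span_span top.extremum_unique)
  ultimately show ?thesis using ind that by blast
qed

text \<open>Needed to differentiate through linear forms on a model space. \<open>K\<close> bounds
  the images of the basis vectors, and \<open>C\<close> turns the coordinate sum into the norm of
  \<open>x\<close>.\<close>

lemma finite_dim_linear_imp_bounded_linear:
  fixes f :: "'a::real_normed_vector \<Rightarrow> 'b::real_normed_vector"
  assumes fin: "\<exists>B::'a set. finite B \<and> span B = UNIV" and f: "linear f"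
  shows "bounded_linear f"
proof -
  obtain B :: "'a set" where B: "finite B" "independent B" "span B = UNIV"
    using finite_dim_basis[OF fin] .
  obtain C where C: "C > 0" "\<forall>u. C * (\<Sum>b\<in>B. \<bar>u b\<bar>) \<le> norm (\<Sum>b\<in>B. u b *\<^sub>R b)"
    using independent_norm_bound[OF B(1,2)] by (elim exE conjE) (rule that)
  define K where "K = (\<Sum>b\<in>B. norm (f b))"
  have "norm (f x) \<le> norm x * (K / C)" for x
  proof -
    have "x \<in> range (\<lambda>u. \<Sum>b\<in>B. u b *\<^sub>R b)"
      using B(3) span_finite[OF B(1)] by simp
    then obtain u where x: "x = (\<Sum>b\<in>B. u b *\<^sub>R b)" by (rule rangeE)
    have "norm (f x) \<le> (\<Sum>b\<in>B. \<bar>u b\<bar> * norm (f b))"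
      unfolding x linear_sum[OF f] linear_cmul[OF f]
      by (rule order_trans[OF norm_sum]) simp
    also have "\<dots> \<le> (\<Sum>b\<in>B. \<bar>u b\<bar> * K)"
      unfolding K_def using B(1)
      by (intro sum_mono mult_left_mono member_le_sum) auto
    also have "\<dots> = (C * (\<Sum>b\<in>B. \<bar>u b\<bar>)) * (K / C)"
      using C(1) by (simp add: sum_distrib_right)
    also have "\<dots> \<le> norm x * (K / C)"
      using C unfolding x by (intro mult_right_mono) (auto simp: K_def intro!: divide_nonneg_pos sum_nonneg)
    finally show ?thesis .
  qed
  then show ?thesis
    by (intro bounded_linear.intro f bounded_linear_axioms.intro exI[of _ "K / C"] allI)
qed

text \<open>Gram--Schmidt: the representing vector over \<^term>\<open>insert b B\<close> is the one over \<^term>\<open>B\<close>, corrected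
  along the component of \<^term>\<open>b\<close> orthogonal to \<^term>\<open>span B\<close>. This avoids determinants, which the
  library only has for matrices indexed by a finite type.\<close>

lemma smooth_riesz_coefficients:
  fixes G :: "'a::real_normed_vector \<Rightarrow> 'b::real_vector \<Rightarrow> 'b \<Rightarrow> real"
  assumes S: "open S"
    and lin: "\<And>x u. x \<in> S \<Longrightarrow> linear (G x u)"
    and sym: "\<And>x u v. x \<in> S \<Longrightarrow> G x u v = G x v u"
    and pos: "\<And>x u. x \<in> S \<Longrightarrow> u \<noteq> 0 \<Longrightarrow> G x u u > 0"
    and smG: "\<And>u v. smooth_on S (\<lambda>x. G x u v)"
    and B: "finite B" "independent B"
    and l: "\<And>x. x \<in> S \<Longrightarrow> linear (l x)" and sml: "\<And>v. smooth_on S (\<lambda>x. l x v)"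
  shows "\<exists>k. (\<forall>b. smooth_on S (k b)) \<and> (\<forall>x\<in>S. \<forall>v\<in>B. G x (\<Sum>b\<in>B. k b x *\<^sub>R b) v = l x v)"
  using B l sml
proof (induction B arbitrary: l rule: finite_induct)
  case empty
  show ?case using smooth_on_const by (intro exI[of _ "\<lambda>_ _. 0"]) auto
next
  case (insert b B)
  have indB: "independent B" and b: "b \<notin> span B"
    using insert.prems(1) insert.hyps(2) by (auto simp: independent_insert)
  have "\<exists>k. (\<forall>b. smooth_on S (k b)) \<and> (\<forall>x\<in>S. \<forall>v\<in>B. G x (\<Sum>b\<in>B. k b x *\<^sub>R b) v = l x v)"
    by (rule insert.IH[OF indB]) (use insert.prems in auto)
  then obtain k0 where k0: "\<forall>b. smooth_on S (k0 b)"
    "\<forall>x\<in>S. \<forall>v\<in>B. G x (\<Sum>b\<in>B. k0 b x *\<^sub>R b) v = l x v"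
    by (elim exE conjE) (rule that)
  \<comment> \<open>The induction hypothesis a second time, now for the form \<open>G x b\<close>:
    its solution is the orthogonal projection of \<open>b\<close> onto
    \<open>span B\<close>.\<close>
  have "\<exists>k. (\<forall>b. smooth_on S (k b)) \<and> (\<forall>x\<in>S. \<forall>v\<in>B. G x (\<Sum>b\<in>B. k b x *\<^sub>R b) v = G x b v)"
    by (rule insert.IH[OF indB]) (use lin smG in auto)
  then obtain k1 where k1: "\<forall>b. smooth_on S (k1 b)"
    "\<forall>x\<in>S. \<forall>v\<in>B. G x (\<Sum>b\<in>B. k1 b x *\<^sub>R b) v = G x b v"
    by (elim exE conjE) (rule that)
  define Y where "Y x = (\<Sum>b\<in>B. k0 b x *\<^sub>R b)" for x
  define e where "e x = b - (\<Sum>b\<in>B. k1 b x *\<^sub>R b)" for x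
  have inspan: "(\<Sum>b\<in>B. k b *\<^sub>R b) \<in> span B" for k :: "'b \<Rightarrow> real"
    by (intro span_sum span_scale span_base)
  have e: "e x \<noteq> 0" for x
    using b inspan[of "\<lambda>b. k1 b x"] by (auto simp: e_def)
  have orth: "G x (e x) v = 0" if x: "x \<in> S" and v: "v \<in> B" for x v
  proof -
    have "G x (e x) v = G x v b - G x v (\<Sum>b\<in>B. k1 b x *\<^sub>R b)"
      unfolding e_def sym[OF x, of _ v] by (rule linear_diff[OF lin[OF x]])
    then show ?thesis
      using k1(2)[rule_format, OF x v] sym[OF x, of v b] sym[OF x, of v "\<Sum>b\<in>B. k1 b x *\<^sub>R b"]
      by simp
  qed
  have orth_sum: "G x (e x) (\<Sum>b\<in>B. k b *\<^sub>R b) = 0" if x: "x \<in> S" for x k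
    by (simp add: linear_sum[OF lin[OF x]] linear_cmul[OF lin[OF x]] orth[OF x])
  \<comment> \<open>The quotient \<open>l x (e x) / G x (e x) (e x)\<close> expanded in
    coefficients, the form in which smoothness can be read off.\<close>
  define c where "c x = (l x b - (\<Sum>b\<in>B. k1 b x * l x b)) / (G x b b - (\<Sum>a\<in>B. k1 a x * G x b a))" for x
  have num: "l x (e x) = l x b - (\<Sum>b\<in>B. k1 b x * l x b)" if x: "x \<in> S" for x
    using insert.prems(2)[OF x] by (simp add: e_def linear_diff linear_sum linear_cmul)
  have eb: "G x (e x) (e x) = G x (e x) b" if x: "x \<in> S" for x
    using orth_sum[OF x, of "\<lambda>b. k1 b x"] linear_diff[OF lin[OF x], of "e x" b] by (simp add: e_def)
  have den: "G x (e x) (e x) = G x b b - (\<Sum>a\<in>B. k1 a x * G x b a)" if x: "x \<in> S" for x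
    unfolding eb[OF x] sym[OF x, of "e x" b]
    by (simp add: e_def linear_diff[OF lin[OF x]] linear_sum[OF lin[OF x]] linear_cmul[OF lin[OF x]])
  have c: "c x = l x (e x) / G x (e x) (e x)" if x: "x \<in> S" for x
    by (simp add: c_def num[OF x] den[OF x])
  have smc: "smooth_on S c"
    unfolding c_def
  proof (rule smooth_on_divide[OF S])
    show "G x b b - (\<Sum>a\<in>B. k1 a x * G x b a) \<noteq> 0" if "x \<in> S" for x
      using den[OF that] pos[OF that e] by (metis less_irrefl)
  qed (use k1(1) smG insert.prems(3) in
      \<open>auto intro!: smooth_on_diff[OF S] smooth_on_sum[OF S] smooth_on_mult[OF S]\<close>)
  \<comment> \<open>Coefficients of \<open>Y x + c x *\<^sub>R e x\<close> over
    \<open>insert b B\<close>.\<close>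
  define k where "k a x = (if a = b then c x else k0 a x - c x * k1 a x)" for a x
  have "smooth_on S (k a)" for a
    unfolding k_def using smc k0(1) k1(1)
    by (cases "a = b") (auto intro!: smooth_on_diff[OF S] smooth_on_mult[OF S])
  moreover have "G x (\<Sum>a\<in>insert b B. k a x *\<^sub>R a) v = l x v" if x: "x \<in> S" and v: "v \<in> insert b B" for x v
  proof -
    have "(\<Sum>a\<in>B. k a x *\<^sub>R a) = (\<Sum>a\<in>B. k0 a x *\<^sub>R a - c x *\<^sub>R k1 a x *\<^sub>R a)"
      using insert.hyps(2) by (intro sum.cong) (auto simp: k_def scaleR_diff_left)
    then have Yk: "(\<Sum>a\<in>insert b B. k a x *\<^sub>R a) = Y x + c x *\<^sub>R e x"
      using insert.hyps
      by (simp add: Y_def e_def k_def sum_subtractf scaleR_sum_right scaleR_diff_right)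
    have lin1: "G x (Y x + c x *\<^sub>R e x) w = G x (Y x) w + c x * G x (e x) w" for w
      unfolding sym[OF x, of _ w] by (simp add: linear_add[OF lin[OF x]] linear_cmul[OF lin[OF x]])
    show ?thesis
    proof (cases "v = b")
      case False
      then show ?thesis using v k0(2) x orth[OF x] unfolding Yk lin1 by (simp add: Y_def)
    next
      case True
      have *: "G x (Y x) w = l x w" if "w = (\<Sum>b\<in>B. k b *\<^sub>R b)" for w k
        using k0(2) x unfolding that
        by (simp add: linear_sum[OF lin[OF x]] linear_cmul[OF lin[OF x]] linear_sum[OF insert.prems(2)[OF x]]
            linear_cmul[OF insert.prems(2)[OF x]] Y_def)
      \<comment> \<open>Splits \<open>b\<close> into its orthogonal part and its projection; on the
        latter \<open>Y x\<close> already represents the form.\<close>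
      have "b = e x + (\<Sum>b\<in>B. k1 b x *\<^sub>R b)" by (simp add: e_def)
      then have "G x (Y x) b = G x (Y x) (e x) + G x (Y x) (\<Sum>b\<in>B. k1 b x *\<^sub>R b)"
        by (metis linear_add[OF lin[OF x]])
      also have "G x (Y x) (e x) = 0" 
        using orth_sum[OF x, of "\<lambda>b. k0 b x"] sym[OF x, of "Y x" "e x"] by (simp add: Y_def)
      also have "G x (Y x) (\<Sum>b\<in>B. k1 b x *\<^sub>R b) = l x b - l x (e x)"
        by (simp add: *[OF refl] num[OF x] linear_sum[OF insert.prems(2)[OF x]] linear_cmul[OF insert.prems(2)[OF x]])
      also have "l x (e x) = c x * G x (e x) b"
        using pos[OF x e, of x] by (simp add: c[OF x] eb[OF x])
      finally show ?thesis unfolding Yk lin1 True by simp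
    qed
  qed
  ultimately show ?case by (intro exI[of _ k]) auto
qed

text \<open>The middle conclusion prepares the normalised gradient: with \<open>l\<close> the
  differential of \<open>h\<close>, the number \<open>l x (Y x)\<close> is the squared length of the
  gradient, which becomes a denominator.\<close>

lemma smooth_riesz:
  fixes G :: "'a::real_normed_vector \<Rightarrow> 'b::real_normed_vector \<Rightarrow> 'b \<Rightarrow> real"
  assumes S: "open S" and fin: "\<exists>B::'b set. finite B \<and> span B = UNIV"
    and lin: "\<And>x u. x \<in> S \<Longrightarrow> linear (G x u)"
    and sym: "\<And>x u v. x \<in> S \<Longrightarrow> G x u v = G x v u"
    and pos: "\<And>x u. x \<in> S \<Longrightarrow> u \<noteq> 0 \<Longrightarrow> G x u u > 0"
    and smG: "\<And>u v. smooth_on S (\<lambda>x. G x u v)"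
    and l: "\<And>x. x \<in> S \<Longrightarrow> linear (l x)" and sml: "\<And>v. smooth_on S (\<lambda>x. l x v)"
  shows "\<exists>Y. smooth_on S Y \<and> smooth_on S (\<lambda>x. l x (Y x)) \<and> (\<forall>x\<in>S. \<forall>v. G x (Y x) v = l x v)"
proof -
  obtain B :: "'b set" where B: "finite B" "independent B" "span B = UNIV"
    using finite_dim_basis[OF fin] .
  have "\<exists>k. (\<forall>b. smooth_on S (k b)) \<and> (\<forall>x\<in>S. \<forall>v\<in>B. G x (\<Sum>b\<in>B. k b x *\<^sub>R b) v = l x v)"
    by (rule smooth_riesz_coefficients[OF S lin sym pos smG B(1,2) l sml])
  then obtain k where k: "\<forall>b. smooth_on S (k b)"
    "\<forall>x\<in>S. \<forall>v\<in>B. G x (\<Sum>b\<in>B. k b x *\<^sub>R b) v = l x v"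
    by (elim exE conjE) (rule that)
  define Y where "Y x = (\<Sum>b\<in>B. k b x *\<^sub>R b)" for x
  have "smooth_on S Y"
    unfolding Y_def using k(1) by (intro smooth_on_sum[OF S] smooth_on_scaleR[OF S] smooth_on_const) auto
  moreover have "smooth_on S (\<lambda>x. l x (Y x))"
  proof -
    have "smooth_on S (\<lambda>x. \<Sum>b\<in>B. k b x * l x b)"
      using k(1) sml by (intro smooth_on_sum[OF S] smooth_on_mult[OF S]) auto
    then show ?thesis
      by (subst smooth_on_cong[OF S, where g = "\<lambda>x. \<Sum>b\<in>B. k b x * l x b"])
        (auto simp: Y_def linear_sum[OF l] linear_cmul[OF l])
  qed
  moreover have "G x (Y x) v = l x v" if x: "x \<in> S" for x v
    using linear_eq_on_span[OF lin[OF x] l[OF x], of B "Y x" v] k(2) x B(3) by (auto simp: Y_def)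
  ultimately show ?thesis by blast
qed

section \<open>Charts, tangent and cotangent spaces\<close>

lemma scaleR_fun_apply [simp]: "(r *\<^sub>R f) x = r *\<^sub>R f x"
  by (simp add: scaleR_fun_def)

lemma linear_betweenI:
  assumes "subspace V" "subspace W" "\<And>v. v \<in> V \<Longrightarrow> f v \<in> W"
    "\<And>u v. u \<in> V \<Longrightarrow> v \<in> V \<Longrightarrow> f (u + v) = f u + f v" "\<And>r v. v \<in> V \<Longrightarrow> f (r *\<^sub>R v) = r *\<^sub>R f v"
  shows "linear_between V W f"
  using assms by (auto simp: linear_between_def)

lemma linear_between_diff:
  assumes "linear_between V W f" "u \<in> V" "v \<in> V"
  shows "f (u - v) = f u - f v"
proof -
  have "subspace V" using assms by (simp add: linear_between_def)
  then have "(- 1) *\<^sub>R v \<in> V" using assms(3) by (rule subspace_scale)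
  moreover have "f ((- 1) *\<^sub>R v) = (- 1) *\<^sub>R f v"
    using assms unfolding linear_between_def by blast
  ultimately have "f (u + (- 1) *\<^sub>R v) = f u + (- 1) *\<^sub>R f v"
    using assms unfolding linear_between_def by metis
  then show ?thesis by simp
qed

locale manifold =
  fixes A :: "('m::{t2_space,second_countable_topology}, 'e::real_normed_vector) chart set"
  assumes smooth_manifold: "smooth_manifold A"
begin

lemma finite_dim: "\<exists>B::'e set. finite B \<and> span B = UNIV"
  using smooth_manifold by (auto simp: smooth_manifold_def)

lemma bounded_linear_model: "linear f \<Longrightarrow> bounded_linear (f :: 'e \<Rightarrow> 'b::real_normed_vector)"
  by (rule finite_dim_linear_imp_bounded_linear[OF finite_dim])

lemma open_cdom: "c \<in> A \<Longrightarrow> open (cdom c)"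
  and open_cimg: "c \<in> A \<Longrightarrow> open (cimg c)"
  and homeomorphism_chart: "c \<in> A \<Longrightarrow> homeomorphism (cdom c) (cimg c) (cmap c) (cinv c)"
  using smooth_manifold by (auto simp: smooth_manifold_def)

lemma charts_at_iff: "c \<in> charts_at A p \<longleftrightarrow> c \<in> A \<and> p \<in> cdom c"
  by (simp add: charts_at_def)

lemma chart_at_in: "chart_at A p \<in> charts_at A p"
proof -
  have "charts_at A p \<noteq> {}" using smooth_manifold by (auto simp: smooth_manifold_def)
  then show ?thesis unfolding chart_at_def by (simp add: some_in_eq)
qed

lemma cinv_cmap: "c \<in> A \<Longrightarrow> p \<in> cdom c \<Longrightarrow> cinv c (cmap c p) = p"
  using homeomorphism_chart by (auto simp: homeomorphism_def)

lemma cmap_cinv: "c \<in> A \<Longrightarrow> x \<in> cimg c \<Longrightarrow> cmap c (cinv c x) = x"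
  using homeomorphism_chart by (auto simp: homeomorphism_def)

lemma cinv_in: "c \<in> A \<Longrightarrow> x \<in> cimg c \<Longrightarrow> cinv c x \<in> cdom c"
  using homeomorphism_image2[OF homeomorphism_chart, of c] by blast

lemma cmap_in: "p \<in> cdom c \<Longrightarrow> cmap c p \<in> cimg c"
  by (simp add: cimg_def)

lemma cinv_chart: "c \<in> A \<Longrightarrow> x \<in> cimg c \<Longrightarrow> c \<in> charts_at A (cinv c x)"
  by (simp add: charts_at_iff cinv_in)

lemma chart_image_eq:
  assumes "c \<in> A"
  shows "cmap c ` (cdom c \<inter> U) = cimg c \<inter> cinv c -` U"
proof
  show "cmap c ` (cdom c \<inter> U) \<subseteq> cimg c \<inter> cinv c -` U"
    using assms by (auto simp: cinv_cmap cmap_in)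
  show "cimg c \<inter> cinv c -` U \<subseteq> cmap c ` (cdom c \<inter> U)"
  proof
    fix x assume "x \<in> cimg c \<inter> cinv c -` U"
    then have "x = cmap c (cinv c x)" "cinv c x \<in> cdom c \<inter> U"
      using assms by (auto simp: cmap_cinv cinv_in)
    then show "x \<in> cmap c ` (cdom c \<inter> U)" by (rule image_eqI)
  qed
qed

lemma open_chart_image:
  assumes "c \<in> A" "open U"
  shows "open (cmap c ` (cdom c \<inter> U))"
proof -
  have "continuous_on (cimg c) (cinv c)"
    using homeomorphism_chart[OF assms(1)] by (simp add: homeomorphism_def)
  then have "open (cimg c \<inter> cinv c -` U)"
    using continuous_open_preimage open_cimg[OF assms(1)] assms(2) by blast
  then show ?thesis by (simp add: chart_image_eq[OF assms(1)])
qed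

lemma transition_smooth:
  "c \<in> A \<Longrightarrow> d \<in> A \<Longrightarrow> smooth_on (cmap c ` (cdom c \<inter> cdom d)) (cmap d \<circ> cinv c)"
  using smooth_manifold by (auto simp: smooth_manifold_def)

lemma transition_differentiable:
  assumes "c \<in> charts_at A p" "d \<in> charts_at A p"
  shows "(cmap d \<circ> cinv c) differentiable (at (cmap c p))"
  by (rule smooth_on_imp_differentiable[OF transition_smooth[of c d]])
    (use assms in \<open>auto simp: charts_at_iff\<close>)

section \<open>Chain rule and change of charts\<close>

text \<open>Near \<open>x0\<close> the curve or map \<open>\<gamma>\<close> stays in the domain of
  \<open>c\<close>, so \<open>cinv c \<circ> cmap c\<close> may be inserted and the chain rule of
  normed spaces applies.\<close>

lemma chart_chain:
  fixes \<gamma> :: "'x::real_normed_vector \<Rightarrow> 'm" and F :: "'m \<Rightarrow> 'y::real_normed_vector"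
  assumes c: "c \<in> A" and U: "open U" "x0 \<in> U" "\<And>x. x \<in> U \<Longrightarrow> \<gamma> x \<in> cdom c"
    and \<gamma>: "(cmap c \<circ> \<gamma>) differentiable (at x0)"
    and F: "(F \<circ> cinv c) differentiable (at (cmap c (\<gamma> x0)))"
  shows "(F \<circ> \<gamma>) differentiable (at x0)"
    and "D (F \<circ> \<gamma>) x0 v = D (F \<circ> cinv c) (cmap c (\<gamma> x0)) (D (cmap c \<circ> \<gamma>) x0 v)"
proof -
  have "(F \<circ> cinv c \<circ> (cmap c \<circ> \<gamma>) has_derivative
      D (F \<circ> cinv c) (cmap c (\<gamma> x0)) \<circ> D (cmap c \<circ> \<gamma>) x0) (at x0)"
    by (rule diff_chain_at[OF has_derivative_D[OF \<gamma>]]) (use has_derivative_D[OF F] in simp)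
  then have "(F \<circ> \<gamma> has_derivative
      D (F \<circ> cinv c) (cmap c (\<gamma> x0)) \<circ> D (cmap c \<circ> \<gamma>) x0) (at x0)"
    by (rule has_derivative_transform_within_open[OF _ U(1,2)]) (use U(3) c in \<open>simp add: cinv_cmap\<close>)
  then show "(F \<circ> \<gamma>) differentiable (at x0)"
    and "D (F \<circ> \<gamma>) x0 v = D (F \<circ> cinv c) (cmap c (\<gamma> x0)) (D (cmap c \<circ> \<gamma>) x0 v)"
    by (auto simp: D_eqI differentiable_def)
qed

text \<open>\<open>chart_chain\<close> along \<open>cinv d\<close>. It makes notions evaluated in
  the chart \<open>chart_at\<close> computable in any other chart around the point.\<close>

lemma chart_change:
  fixes F :: "'m \<Rightarrow> 'y::real_normed_vector"
  assumes c: "c \<in> charts_at A p" and d: "d \<in> charts_at A p"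
    and F: "(F \<circ> cinv c) differentiable (at (cmap c p))"
  shows "(F \<circ> cinv d) differentiable (at (cmap d p))"
    and "D (F \<circ> cinv d) (cmap d p) v = D (F \<circ> cinv c) (cmap c p) (D (cmap c \<circ> cinv d) (cmap d p) v)"
proof -
  have cd: "c \<in> A" "d \<in> A" "p \<in> cdom c" "p \<in> cdom d" using c d by (auto simp: charts_at_iff)
  note * = chart_chain[OF cd(1) open_chart_image[OF cd(2) open_cdom[OF cd(1)]], of "cmap d p" "cinv d" F]
  have "cinv d x \<in> cdom c" if "x \<in> cmap d ` (cdom d \<inter> cdom c)" for x
    using that cd by (auto simp: cinv_cmap)
  then show "(F \<circ> cinv d) differentiable (at (cmap d p))"
    and "D (F \<circ> cinv d) (cmap d p) v = D (F \<circ> cinv c) (cmap c p) (D (cmap c \<circ> cinv d) (cmap d p) v)"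
    using * transition_differentiable[OF d c] F cd by (auto simp: cinv_cmap)
qed

lemma D_transition_self:
  assumes "c \<in> charts_at A p"
  shows "D (cmap c \<circ> cinv c) (cmap c p) v = v"
proof -
  have c: "c \<in> A" "p \<in> cdom c" using assms by (auto simp: charts_at_iff)
  have "D (cmap c \<circ> cinv c) (cmap c p) = D (\<lambda>x. x) (cmap c p)"
    by (rule D_cong[OF open_cimg[OF c(1)]]) (use c in \<open>auto simp: cmap_in cmap_cinv\<close>)
  then show ?thesis by simp
qed

section \<open>Tangent vectors and their components\<close>

lemma tangent_component:
  "v \<in> tangent_space A p \<Longrightarrow> c \<in> charts_at A p \<Longrightarrow> d \<in> charts_at A p \<Longrightarrow>
    v d = D (cmap d \<circ> cinv c) (cmap c p) (v c)"
  unfolding tangent_space_def by blast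

lemma tangent_zero: "v \<in> tangent_space A p \<Longrightarrow> d \<notin> charts_at A p \<Longrightarrow> v d = 0"
  unfolding tangent_space_def by blast

lemma linear_D_transition:
  "c \<in> charts_at A p \<Longrightarrow> d \<in> charts_at A p \<Longrightarrow> linear (D (cmap d \<circ> cinv c) (cmap c p))"
  by (intro linear_frechet_derivative transition_differentiable)

text \<open>The transformation law is the cocycle property of transition derivatives, that is
  \<open>chart_change\<close> applied to a transition map.\<close>

lemma coord_vector_in:
  assumes c: "c \<in> charts_at A p"
  shows "coord_vector A c p u \<in> tangent_space A p"
  unfolding tangent_space_def
proof (intro CollectI conjI ballI allI impI)
  fix d d' assume d: "d \<in> charts_at A p" "d' \<in> charts_at A p"
  show "coord_vector A c p u d' = D (cmap d' \<circ> cinv d) (cmap d p) (coord_vector A c p u d)"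
    using chart_change(2)[OF d(1) c transition_differentiable[OF d], of u] d by (simp add: coord_vector_def)
qed (simp add: coord_vector_def)

lemma coord_vector_self: "c \<in> charts_at A p \<Longrightarrow> coord_vector A c p u c = u"
  by (simp add: coord_vector_def D_transition_self)

lemma coord_vector_component:
  "v \<in> tangent_space A p \<Longrightarrow> c \<in> charts_at A p \<Longrightarrow> coord_vector A c p (v c) = v"
  by (rule ext) (simp add: coord_vector_def tangent_component[symmetric] tangent_zero)

lemma tangent_eqI:
  "v \<in> tangent_space A p \<Longrightarrow> w \<in> tangent_space A p \<Longrightarrow> c \<in> charts_at A p \<Longrightarrow> v c = w c \<Longrightarrow> v = w"
  by (metis coord_vector_component)

lemma linear_coord_vector:
  assumes "c \<in> charts_at A p"
  shows "linear (coord_vector A c p)"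
  by (rule linearI; rule ext)
    (simp_all add: coord_vector_def linear_add[OF linear_D_transition[OF assms]]
      linear_cmul[OF linear_D_transition[OF assms]])

lemma tangent_space_eq_range: "c \<in> charts_at A p \<Longrightarrow> tangent_space A p = range (coord_vector A c p)"
  by (auto simp: coord_vector_in intro: range_eqI coord_vector_component[symmetric])

lemma subspace_tangent_space: "subspace (tangent_space A p)"
  unfolding tangent_space_eq_range[OF chart_at_in]
  by (intro linear_subspace_image linear_coord_vector[OF chart_at_in] subspace_UNIV)

section \<open>Covectors\<close>

lemma cotangent_linear:
  "\<alpha> \<in> cotangent_space A p \<Longrightarrow> linear_between (tangent_space A p) UNIV \<alpha>"
  by (simp add: cotangent_space_def)

lemma cotangent_add:
  "\<alpha> \<in> cotangent_space A p \<Longrightarrow> u \<in> tangent_space A p \<Longrightarrow> v \<in> tangent_space A p \<Longrightarrow> \<alpha> (u + v) = \<alpha> u + \<alpha> v"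
  and cotangent_scale:
  "\<alpha> \<in> cotangent_space A p \<Longrightarrow> v \<in> tangent_space A p \<Longrightarrow> \<alpha> (r *\<^sub>R v) = r * \<alpha> v"
  using cotangent_linear[of \<alpha> p] by (auto simp: linear_between_def)

lemma cotangent_diff:
  "\<alpha> \<in> cotangent_space A p \<Longrightarrow> u \<in> tangent_space A p \<Longrightarrow> v \<in> tangent_space A p \<Longrightarrow> \<alpha> (u - v) = \<alpha> u - \<alpha> v"
  by (rule linear_between_diff[OF cotangent_linear])

lemma subspace_cotangent_space: "subspace (cotangent_space A p)"
proof (rule subspaceI)
  show "0 \<in> cotangent_space A p"
    by (auto simp: cotangent_space_def intro!: linear_betweenI subspace_tangent_space)
next
  fix \<alpha> \<beta> assume "\<alpha> \<in> cotangent_space A p" "\<beta> \<in> cotangent_space A p"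
  then show "\<alpha> + \<beta> \<in> cotangent_space A p"
    by (auto simp: cotangent_space_def linear_between_def algebra_simps)
next
  fix r \<alpha> assume "\<alpha> \<in> cotangent_space A p"
  then show "r *\<^sub>R \<alpha> \<in> cotangent_space A p"
    by (auto simp: cotangent_space_def linear_between_def algebra_simps)
qed

lemma coord_covector_in:
  assumes a: "linear a"
  shows "coord_covector A c p a \<in> cotangent_space A p"
proof -
  have "linear_between (tangent_space A p) UNIV (coord_covector A c p a)"
    by (rule linear_betweenI)
      (auto simp: subspace_tangent_space coord_covector_def subspace_add subspace_scale
        linear_add[OF a] linear_cmul[OF a])
  then show ?thesis by (simp add: cotangent_space_def coord_covector_def)
qed

lemma linear_cotangent_coord:
  assumes "\<alpha> \<in> cotangent_space A p" "c \<in> charts_at A p"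
  shows "linear (\<lambda>u. \<alpha> (coord_vector A c p u))"
  by (rule linearI)
    (simp_all add: linear_add[OF linear_coord_vector[OF assms(2)]] linear_cmul[OF linear_coord_vector[OF assms(2)]]
      cotangent_add[OF assms(1)] cotangent_scale[OF assms(1)] coord_vector_in[OF assms(2)])

text \<open>Makes the description in \<open>sharp\<close> unique. If \<open>v c - w c\<close> were
  nonzero, a linear form with value 1 on it could be extended from this independent singleton to the
  model space.\<close>

lemma cotangent_separates:
  assumes v: "v \<in> tangent_space A p" and w: "w \<in> tangent_space A p"
    and eq: "\<And>\<beta>. \<beta> \<in> cotangent_space A p \<Longrightarrow> \<beta> v = \<beta> w"
  shows "v = w"
proof (rule ccontr)
  define c where "c = chart_at A p"
  have c: "c \<in> charts_at A p" by (simp add: c_def chart_at_in)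
  assume "v \<noteq> w"
  then have "v c - w c \<noteq> 0" using tangent_eqI[OF v w c] by auto
  then have "independent {v c - w c}" by (simp add: dependent_single)
  then obtain a :: "'e \<Rightarrow> real" where a: "linear a" "a (v c - w c) = 1"
    using linear_independent_extend[of "{v c - w c}" "\<lambda>_. 1 :: real"] by auto
  have "coord_covector A c p a v = coord_covector A c p a w"
    by (rule eq[OF coord_covector_in[OF a(1)]])
  then show False using a(2) v w by (simp add: coord_covector_def linear_diff[OF a(1)])
qed

section \<open>Decomposable bivectors, their sharp map and rank\<close>

lemma wedge_in:
  assumes Y: "Y \<in> tangent_space A p" and X: "X \<in> tangent_space A p"
  shows "wedge A p Y X \<in> bivector_space A p"
proof -
  have "linear_between (cotangent_space A p) UNIV (wedge A p Y X \<alpha>)" if "\<alpha> \<in> cotangent_space A p" for \<alpha>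
    by (rule linear_betweenI)
      (use that in \<open>auto simp: subspace_cotangent_space wedge_def subspace_add subspace_scale algebra_simps\<close>)
  then show ?thesis by (auto simp: bivector_space_def wedge_def)
qed

lemma sharp_wedge:
  assumes Y: "Y \<in> tangent_space A p" and X: "X \<in> tangent_space A p" and \<alpha>: "\<alpha> \<in> cotangent_space A p"
  shows "sharp A p (wedge A p Y X) \<alpha> = \<alpha> Y *\<^sub>R X - \<alpha> X *\<^sub>R Y"
  unfolding sharp_def
proof (rule the_equality)
  have in_T: "\<alpha> Y *\<^sub>R X \<in> tangent_space A p" "\<alpha> X *\<^sub>R Y \<in> tangent_space A p"
    using assms subspace_scale[OF subspace_tangent_space] by auto
  have "\<beta> (\<alpha> Y *\<^sub>R X - \<alpha> X *\<^sub>R Y) = wedge A p Y X \<alpha> \<beta>" if "\<beta> \<in> cotangent_space A p" for \<beta>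
    using that \<alpha> by (simp add: wedge_def cotangent_diff[OF that in_T] cotangent_scale[OF that] X Y)
  moreover have T: "\<alpha> Y *\<^sub>R X - \<alpha> X *\<^sub>R Y \<in> tangent_space A p"
    by (rule subspace_diff[OF subspace_tangent_space in_T])
  ultimately show *: "\<alpha> Y *\<^sub>R X - \<alpha> X *\<^sub>R Y \<in> tangent_space A p \<and>
      (\<forall>\<beta>\<in>cotangent_space A p. \<beta> (\<alpha> Y *\<^sub>R X - \<alpha> X *\<^sub>R Y) = wedge A p Y X \<alpha> \<beta>)" by blast
  show "v = \<alpha> Y *\<^sub>R X - \<alpha> X *\<^sub>R Y"
    if v: "v \<in> tangent_space A p \<and> (\<forall>\<beta>\<in>cotangent_space A p. \<beta> v = wedge A p Y X \<alpha> \<beta>)" for v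
    by (rule cotangent_separates[OF conjunct1[OF v] T]) (use v * in simp)
qed

lemma rank_wedge:
  assumes Y: "Y \<in> tangent_space A p" and X: "X \<in> tangent_space A p"
  shows "bivector_rank A p (wedge A p Y X) \<le> 2"
proof -
  have "sharp A p (wedge A p Y X) ` cotangent_space A p \<subseteq> span {X, Y}"
    by (auto simp: sharp_wedge[OF Y X] intro!: span_diff span_scale intro: span_base)
  then have "dim (sharp A p (wedge A p Y X) ` cotangent_space A p) \<le> card {X, Y}"
    by (rule dim_le_card) simp
  also have "\<dots> \<le> 2" by (simp add: card_insert_if)
  finally show ?thesis by (simp add: bivector_rank_def)
qed

section \<open>The differential of a function\<close>

lemma smooth_fun_differentiable:
  assumes "smooth_fun A h" "c \<in> charts_at A p"
  shows "(h \<circ> cinv c) differentiable (at (cmap c p))"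
  by (rule smooth_on_imp_differentiable[of "cimg c"])
    (use assms in \<open>auto simp: smooth_fun_def charts_at_iff cmap_in\<close>)

lemma differential_eq:
  assumes h: "smooth_fun A h" and c: "c \<in> charts_at A p" and v: "v \<in> tangent_space A p"
  shows "differential A h p v = D (h \<circ> cinv c) (cmap c p) (v c)"
proof -
  define d where "d = chart_at A p"
  have d: "d \<in> charts_at A p" by (simp add: d_def chart_at_in)
  have "D (h \<circ> cinv c) (cmap c p) (v c) = D (h \<circ> cinv d) (cmap d p) (D (cmap d \<circ> cinv c) (cmap c p) (v c))"
    by (rule chart_change(2)[OF d c smooth_fun_differentiable[OF h d]])
  then show ?thesis
    using v by (simp add: differential_def d_def[symmetric] coord_covector_def tangent_component[OF v c d])
qed

lemma differential_in: "smooth_fun A h \<Longrightarrow> differential A h p \<in> cotangent_space A p"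
  unfolding differential_def Let_def
  by (intro coord_covector_in linear_frechet_derivative smooth_fun_differentiable chart_at_in)

end

section \<open>Bivectors spanned by commuting vector fields\<close>

definition vector_field ::
    "('m, 'e::real_normed_vector) chart set \<Rightarrow> ('m \<Rightarrow> ('m, 'e) tvec) \<Rightarrow> bool"
  where "vector_field A X \<longleftrightarrow> (\<forall>p. X p \<in> tangent_space A p) \<and>
    (\<forall>c\<in>A. smooth_on (cimg c) (\<lambda>x. X (cinv c x) c))"

context manifold
begin

text \<open>Valid for every \<open>x\<close>, even off the chart image, since
  \<open>coord_covector\<close> just reads the component at \<open>c\<close> of a tangent vector. It
  can thus be used as an equality of functions under the derivative.\<close>

lemma local_comp_wedge:
  assumes YX: "\<And>p. Y p \<in> tangent_space A p" "\<And>p. X p \<in> tangent_space A p"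
    and a: "linear a" and b: "linear b"
  shows "local_comp A c (\<lambda>p. wedge A p (Y p) (X p)) a b x
    = a (Y (cinv c x) c) * b (X (cinv c x) c) - a (X (cinv c x) c) * b (Y (cinv c x) c)"
  by (simp add: local_comp_def wedge_def coord_covector_in a b)
    (simp add: coord_covector_def YX)

lemma bivector_field_wedge:
  assumes Y: "vector_field A Y" and X: "vector_field A X"
  shows "bivector_field A (\<lambda>p. wedge A p (Y p) (X p))"
proof -
  have YX: "\<And>p. Y p \<in> tangent_space A p" "\<And>p. X p \<in> tangent_space A p"
    using Y X by (auto simp: vector_field_def)
  have "smooth_on (cimg c) (local_comp A c (\<lambda>p. wedge A p (Y p) (X p)) a b)"
    if c: "c \<in> A" and a: "linear a" and b: "linear b" for c a b
  proof -
    have "smooth_on (cimg c)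
        (\<lambda>x. a (Y (cinv c x) c) * b (X (cinv c x) c) - a (X (cinv c x) c) * b (Y (cinv c x) c))"
      using Y X c unfolding vector_field_def
      by (intro smooth_on_diff smooth_on_mult open_cimg
          smooth_on_bounded_linear[OF _ bounded_linear_model[OF a]]
          smooth_on_bounded_linear[OF _ bounded_linear_model[OF b]]) auto
    moreover have "local_comp A c (\<lambda>p. wedge A p (Y p) (X p)) a b =
        (\<lambda>x. a (Y (cinv c x) c) * b (X (cinv c x) c) - a (X (cinv c x) c) * b (Y (cinv c x) c))"
      by (rule ext) (rule local_comp_wedge[OF YX a b])
    ultimately show ?thesis by simp
  qed
  then show ?thesis
    unfolding bivector_field_def using wedge_in[OF YX] by blast
qed

text \<open>The condition \<open>comm\<close> is \<open>[Y, X] = 0\<close> in the very chart in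
  which \<open>schouten_summand\<close> differentiates. Each summand becomes a polynomial in the
  values of the covectors on \<open>Y\<close>, \<open>X\<close> and their derivatives along each
  other and themselves, and the cyclic sum cancels.\<close>

lemma schouten_bracket_commuting:
  assumes Y: "vector_field A Y" and X: "vector_field A X"
    and comm: "\<And>p. let c = chart_at A p in
      D (\<lambda>x. Y (cinv c x) c) (cmap c p) (X p c) = D (\<lambda>x. X (cinv c x) c) (cmap c p) (Y p c)"
  shows "schouten_bracket A (\<lambda>p. wedge A p (Y p) (X p)) (\<lambda>p. wedge A p (Y p) (X p)) = 0"
proof -
  let ?P = "\<lambda>p. wedge A p (Y p) (X p)"
  have YX: "\<And>p. Y p \<in> tangent_space A p" "\<And>p. X p \<in> tangent_space A p"
    using Y X by (auto simp: vector_field_def)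
  have "schouten_summand A ?P ?P p \<alpha> \<beta> \<gamma> + schouten_summand A ?P ?P p \<alpha> \<beta> \<gamma>
       + schouten_summand A ?P ?P p \<beta> \<gamma> \<alpha> + schouten_summand A ?P ?P p \<beta> \<gamma> \<alpha>
       + schouten_summand A ?P ?P p \<gamma> \<alpha> \<beta> + schouten_summand A ?P ?P p \<gamma> \<alpha> \<beta> = 0"
    if cot: "\<alpha> \<in> cotangent_space A p" "\<beta> \<in> cotangent_space A p" "\<gamma> \<in> cotangent_space A p" for p \<alpha> \<beta> \<gamma>
  proof -
    define c where "c = chart_at A p"
    have c: "c \<in> charts_at A p" by (simp add: c_def chart_at_in)
    then have cA: "c \<in> A" and pc: "p \<in> cdom c" by (auto simp: charts_at_iff)
    define y where "y = cmap c p"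
    define Yc where "Yc x = Y (cinv c x) c" for x
    define Xc where "Xc x = X (cinv c x) c" for x
    have y: "y \<in> cimg c" "cinv c y = p" using cA pc by (auto simp: y_def cmap_in cinv_cmap)
    have "Yc differentiable (at y)" "Xc differentiable (at y)"
      using Y X cA y unfolding vector_field_def Yc_def Xc_def
      by (auto intro: smooth_on_imp_differentiable)
    note dYX = has_derivative_D[OF this(1)] has_derivative_D[OF this(2)]
    note lin = dYX[THEN has_derivative_linear]
    \<comment> \<open>By \<open>comm\<close> this is also the derivative of \<open>X\<close> along
      \<open>Y\<close>, so \<open>Z\<close>, \<open>U\<close>, \<open>W\<close> stand for all four
      derivatives.\<close>
    define Z where "Z = D Yc y (Xc y)"
    define U where "U = D Yc y (Yc y)"
    define W where "W = D Xc y (Xc y)"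
    have Z: "D Xc y (Yc y) = Z"
      using comm[of p] unfolding Z_def Yc_def Xc_def Let_def c_def[symmetric] y_def[symmetric] y(2) by simp
    \<comment> \<open>The covector read in the chart; its components are held constant, as in the
      definition of the bracket.\<close>
    define f where "f \<eta> u = \<eta> (coord_vector A c p u)" for \<eta> :: "('m, 'e) covec" and u :: 'e
    have at: "\<eta> (Y p) = f \<eta> (Yc y)" "\<eta> (X p) = f \<eta> (Xc y)" for \<eta>
      by (simp_all add: f_def Yc_def Xc_def y(2) coord_vector_component[OF YX(1) c] coord_vector_component[OF YX(2) c])
    have summand: "schouten_summand A ?P ?P p \<eta> \<theta> \<zeta> =
        f \<theta> (Yc y) * (f \<eta> (Yc y) * f \<zeta> W - f \<eta> (Xc y) * f \<zeta> Z)
        + (f \<eta> (Yc y) * f \<theta> Z - f \<eta> (Xc y) * f \<theta> U) * f \<zeta> (Xc y)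
        - (f \<theta> (Xc y) * (f \<eta> (Yc y) * f \<zeta> Z - f \<eta> (Xc y) * f \<zeta> U)
        + (f \<eta> (Yc y) * f \<theta> W - f \<eta> (Xc y) * f \<theta> Z) * f \<zeta> (Yc y))"
      if cov: "\<eta> \<in> cotangent_space A p" "\<theta> \<in> cotangent_space A p" "\<zeta> \<in> cotangent_space A p" for \<eta> \<theta> \<zeta>
    proof -
      have lf: "linear (f \<theta>)" "linear (f \<zeta>)"
        unfolding f_def by (intro linear_cotangent_coord cov c)+
      note blf = lf[THEN bounded_linear_model, THEN bounded_linear_imp_has_derivative]
      have dYX': "((\<lambda>x. f \<theta> (Yc x)) has_derivative (\<lambda>v. f \<theta> (D Yc y v))) (at y)"
        "((\<lambda>x. f \<zeta> (Yc x)) has_derivative (\<lambda>v. f \<zeta> (D Yc y v))) (at y)"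
        "((\<lambda>x. f \<theta> (Xc x)) has_derivative (\<lambda>v. f \<theta> (D Xc y v))) (at y)"
        "((\<lambda>x. f \<zeta> (Xc x)) has_derivative (\<lambda>v. f \<zeta> (D Xc y v))) (at y)"
        using bounded_linear.has_derivative[OF bounded_linear_model[OF lf(1)]]
          bounded_linear.has_derivative[OF bounded_linear_model[OF lf(2)]] dYX by blast+
      \<comment> \<open>Chart component of \<open>P\<^sup>\<sharp>\<eta>\<close>, the direction in
        which the summand differentiates.\<close>
      define w where "w = f \<eta> (Yc y) *\<^sub>R Xc y - f \<eta> (Xc y) *\<^sub>R Yc y"
      have sharp: "sharp A p (?P p) \<eta> c = w"
        using sharp_wedge[OF YX cov(1)] by (simp add: w_def at Xc_def Yc_def y(2))
      have "local_comp A c ?P (f \<theta>) (f \<zeta>) =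
          (\<lambda>x. f \<theta> (Yc x) * f \<zeta> (Xc x) - f \<theta> (Xc x) * f \<zeta> (Yc x))"
        by (rule ext) (simp only: local_comp_wedge[OF YX lf] Yc_def Xc_def)
      then have "schouten_summand A ?P ?P p \<eta> \<theta> \<zeta> =
          D (\<lambda>x. f \<theta> (Yc x) * f \<zeta> (Xc x) - f \<theta> (Xc x) * f \<zeta> (Yc x)) y w"
        unfolding schouten_summand_def Let_def c_def[symmetric] y_def[symmetric] sharp f_def[symmetric]
        by simp
      also have "D (\<lambda>x. f \<theta> (Yc x) * f \<zeta> (Xc x) - f \<theta> (Xc x) * f \<zeta> (Yc x)) y =
          (\<lambda>v. (f \<theta> (Yc y) * f \<zeta> (D Xc y v) + f \<theta> (D Yc y v) * f \<zeta> (Xc y))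
            - (f \<theta> (Xc y) * f \<zeta> (D Yc y v) + f \<theta> (D Xc y v) * f \<zeta> (Yc y)))"
        by (intro D_eqI has_derivative_diff has_derivative_mult dYX')
      also have "D Xc y w = f \<eta> (Yc y) *\<^sub>R W - f \<eta> (Xc y) *\<^sub>R Z"
        by (simp add: w_def linear_diff[OF lin(2)] linear_cmul[OF lin(2)] Z W_def)
      also have "D Yc y w = f \<eta> (Yc y) *\<^sub>R Z - f \<eta> (Xc y) *\<^sub>R U"
        by (simp add: w_def linear_diff[OF lin(1)] linear_cmul[OF lin(1)] Z_def U_def)
      finally show ?thesis
        by (simp add: linear_diff[OF lf(1)] linear_cmul[OF lf(1)] linear_diff[OF lf(2)] linear_cmul[OF lf(2)])
    qed
    \<comment> \<open>The terms with \<open>W\<close>, with \<open>U\<close> and with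
      \<open>Z\<close> cancel separately between the cyclic permutations.\<close>
    show ?thesis
      unfolding summand[OF cot] summand[OF cot(2,3,1)] summand[OF cot(3,1,2)]
      by (simp add: algebra_simps)
  qed
  then show ?thesis
    by (intro ext) (simp add: schouten_bracket_def)
qed

lemma poisson_structure_commuting:
  assumes "vector_field A Y" "vector_field A X"
    "\<And>p. let c = chart_at A p in
      D (\<lambda>x. Y (cinv c x) c) (cmap c p) (X p c) = D (\<lambda>x. X (cinv c x) c) (cmap c p) (Y p c)"
  shows "poisson_structure A (\<lambda>p. wedge A p (Y p) (X p))"
  unfolding poisson_structure_def
  using bivector_field_wedge schouten_bracket_commuting assms by blast

end

section \<open>Tangent maps and gradients\<close>

text \<open>\<open>chart_chain\<close> along \<open>f \<circ> cinv c\<close>; continuity of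
  \<open>f\<close> makes the coordinate region mapped into the domain of \<open>d\<close>
  open.\<close>

lemma smooth_map_chain:
  fixes F :: "'n::{t2_space,second_countable_topology} \<Rightarrow> 'y::real_normed_vector"
  assumes A: "manifold A" and B: "manifold B" and f: "smooth_map A B f"
    and c: "c \<in> charts_at A p" and d: "d \<in> charts_at B (f p)"
    and F: "(F \<circ> cinv d) differentiable (at (cmap d (f p)))"
  shows "(F \<circ> f \<circ> cinv c) differentiable (at (cmap c p))"
    and "D (F \<circ> f \<circ> cinv c) (cmap c p) v =
      D (F \<circ> cinv d) (cmap d (f p)) (D (cmap d \<circ> f \<circ> cinv c) (cmap c p) v)"
proof -
  interpret A: manifold A by (rule A)
  interpret B: manifold B by (rule B)
  define U where "U = cmap c ` (cdom c \<inter> f -` cdom d)"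
  have cd: "c \<in> A" "p \<in> cdom c" "d \<in> B" "f p \<in> cdom d"
    using c d by (auto simp: A.charts_at_iff B.charts_at_iff)
  have "open (f -` cdom d)"
    using f B.open_cdom[OF cd(3)] by (auto simp: smooth_map_def intro: open_vimage)
  then have U: "open U" unfolding U_def by (rule A.open_chart_image[OF cd(1)])
  have p: "cmap c p \<in> U" using cd by (auto simp: U_def)
  have dom: "(f \<circ> cinv c) x \<in> cdom d" if "x \<in> U" for x
    using that cd by (auto simp: U_def A.cinv_cmap)
  have "smooth_on U (cmap d \<circ> f \<circ> cinv c)"
    using f cd unfolding smooth_map_def U_def by blast
  then have "(cmap d \<circ> (f \<circ> cinv c)) differentiable (at (cmap c p))"
    using p by (simp add: smooth_on_imp_differentiable comp_assoc)
  note * = B.chart_chain[OF cd(3) U p dom this, of F]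
  show "(F \<circ> f \<circ> cinv c) differentiable (at (cmap c p))"
    and "D (F \<circ> f \<circ> cinv c) (cmap c p) v =
      D (F \<circ> cinv d) (cmap d (f p)) (D (cmap d \<circ> f \<circ> cinv c) (cmap c p) v)"
    using * F cd by (simp_all add: comp_assoc A.cinv_cmap)
qed

context
  fixes A :: "('m::{t2_space,second_countable_topology}, 'e::real_normed_vector) chart set"
    and B :: "('n::{t2_space,second_countable_topology}, 'f::real_normed_vector) chart set"
    and f :: "'m \<Rightarrow> 'n"
  assumes A: "manifold A" and B: "manifold B" and f: "smooth_map A B f"
begin

interpretation A: manifold A by (rule A)
interpretation B: manifold B by (rule B)

lemma smooth_map_differentiable:
  assumes "c \<in> charts_at A p" "d \<in> charts_at B (f p)"
  shows "(cmap d \<circ> f \<circ> cinv c) differentiable (at (cmap c p))"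
  by (rule smooth_map_chain(1)[OF A B f assms B.transition_differentiable[OF assms(2,2)]])

lemma tangent_map_component:
  assumes c: "c \<in> charts_at A p" and d: "d \<in> charts_at B (f p)" and v: "v \<in> tangent_space A p"
  shows "tangent_map A B f p v d = D (cmap d \<circ> f \<circ> cinv c) (cmap c p) (v c)"
proof -
  define c' where "c' = chart_at A p"
  have c': "c' \<in> charts_at A p" by (simp add: c'_def A.chart_at_in)
  show ?thesis
    using A.chart_change(2)[OF c' c smooth_map_differentiable[OF c' d], of "v c"] d
    by (simp add: tangent_map_def c'_def[symmetric] A.tangent_component[OF v c c'])
qed

lemma tangent_map_in: "tangent_map A B f p v \<in> tangent_space B (f p)"
  unfolding tangent_space_def
proof (intro CollectI conjI ballI allI impI)
  fix d d' assume d: "d \<in> charts_at B (f p)" "d' \<in> charts_at B (f p)"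
  show "tangent_map A B f p v d' = D (cmap d' \<circ> cinv d) (cmap d (f p)) (tangent_map A B f p v d)"
    using smooth_map_chain(2)[OF A B f A.chart_at_in d(1) B.transition_differentiable[OF d]] d
    by (simp add: tangent_map_def Let_def)
qed (simp add: tangent_map_def Let_def)

lemma linear_tangent_map: "linear (tangent_map A B f p)"
proof -
  have l: "linear (D (cmap d \<circ> f \<circ> cinv (chart_at A p)) (cmap (chart_at A p) p))"
    if "d \<in> charts_at B (f p)" for d
    by (intro linear_frechet_derivative smooth_map_differentiable A.chart_at_in that)
  show ?thesis
    by (rule linearI; rule ext)
      (simp_all add: tangent_map_def Let_def linear_add[OF l] linear_cmul[OF l])
qed

text \<open>The right side is left as a derivative of \<open>h \<circ> f\<close>, so that invariance
  of \<open>h\<close> can be applied as an equality of functions.\<close>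

lemma differential_tangent_map:
  assumes h: "smooth_fun B h" and c: "c \<in> charts_at A p" and v: "v \<in> tangent_space A p"
  shows "differential B h (f p) (tangent_map A B f p v) = D (h \<circ> f \<circ> cinv c) (cmap c p) (v c)"
proof -
  define d where "d = chart_at B (f p)"
  have d: "d \<in> charts_at B (f p)" by (simp add: d_def B.chart_at_in)
  show ?thesis
    unfolding B.differential_eq[OF h d tangent_map_in] tangent_map_component[OF c d v]
    by (rule smooth_map_chain(2)[OF A B f c d B.smooth_fun_differentiable[OF h d], symmetric])
qed

end

text \<open>Functoriality, by the chain rule through a chart at \<open>f p\<close>; it serves to
  invert the pushforward by a group element.\<close>

lemma tangent_map_comp:
  assumes A: "manifold A" and B: "manifold B" and C: "manifold C"
    and f: "smooth_map A B f" and k: "smooth_map B C k" and v: "v \<in> tangent_space A p"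
  shows "tangent_map B C k (f p) (tangent_map A B f p v) = tangent_map A C (k \<circ> f) p v"
proof
  fix d
  interpret A: manifold A by (rule A)
  interpret B: manifold B by (rule B)
  define b where "b = chart_at B (f p)"
  have b: "b \<in> charts_at B (f p)" by (simp add: b_def B.chart_at_in)
  define c where "c = chart_at A p"
  have c: "c \<in> charts_at A p" by (simp add: c_def A.chart_at_in)
  show "tangent_map B C k (f p) (tangent_map A B f p v) d = tangent_map A C (k \<circ> f) p v d"
  proof (cases "d \<in> charts_at C ((k \<circ> f) p)")
    case True
    then have d: "d \<in> charts_at C (k (f p))" by simp
    have "tangent_map B C k (f p) (tangent_map A B f p v) d =
        D (cmap d \<circ> k \<circ> cinv b) (cmap b (f p)) (D (cmap b \<circ> f \<circ> cinv c) (cmap c p) (v c))"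
      unfolding tangent_map_component[OF B C k b d tangent_map_in[OF A B f]]
        tangent_map_component[OF A B f c b v] ..
    also have "\<dots> = D (cmap d \<circ> k \<circ> f \<circ> cinv c) (cmap c p) (v c)"
      by (rule smooth_map_chain(2)[OF A B f c b smooth_map_differentiable[OF B C k b d], symmetric])
    finally show ?thesis
      using True by (simp add: tangent_map_def Let_def c_def[symmetric] comp_assoc)
  qed (simp add: tangent_map_def Let_def)
qed

context manifold
begin

lemma tangent_map_id:
  assumes v: "v \<in> tangent_space A p"
  shows "tangent_map A A id p v = v"
proof
  fix d
  show "tangent_map A A id p v d = v d"
    using tangent_component[OF v chart_at_in, of d] tangent_zero[OF v, of d]
    by (simp add: tangent_map_def Let_def)
qed

end

section \<open>The gradient, its length and its normalisation\<close>

locale riemannian = manifold A for A :: "('m::{t2_space,second_countable_topology}, 'e::real_normed_vector) chart set" +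
  fixes g :: "'m \<Rightarrow> ('m, 'e) tvec \<Rightarrow> ('m, 'e) tvec \<Rightarrow> real" and h :: "'m \<Rightarrow> real"
  assumes metric: "riemannian_metric A g" and smooth_h: "smooth_fun A h"
begin

lemma metric_linear: "u \<in> tangent_space A p \<Longrightarrow> linear_between (tangent_space A p) UNIV (g p u)"
  and metric_sym: "u \<in> tangent_space A p \<Longrightarrow> v \<in> tangent_space A p \<Longrightarrow> g p u v = g p v u"
  and metric_pos: "u \<in> tangent_space A p \<Longrightarrow> u \<noteq> 0 \<Longrightarrow> g p u u > 0"
  using metric unfolding riemannian_metric_def by blast+

lemma metric_smooth: "c \<in> A \<Longrightarrow> smooth_on (cimg c)
    (\<lambda>x. g (cinv c x) (coord_vector A c (cinv c x) u) (coord_vector A c (cinv c x) v))"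
  using metric[unfolded riemannian_metric_def, THEN conjunct2] by simp

text \<open>Positive definiteness, applied to the difference of two candidates.\<close>

lemma gradient_unique:
  assumes w: "w \<in> tangent_space A p" "\<And>v. v \<in> tangent_space A p \<Longrightarrow> g p w v = differential A h p v"
  shows "gradient A g h p = w"
  unfolding gradient_def
proof (rule the_equality)
  fix w' assume w': "w' \<in> tangent_space A p \<and> (\<forall>v\<in>tangent_space A p. g p w' v = differential A h p v)"
  have d: "w' - w \<in> tangent_space A p"
    using w(1) w' by (simp add: subspace_diff[OF subspace_tangent_space])
  have "g p (w' - w) (w' - w) = g p (w' - w) w' - g p (w' - w) w"
    using w(1) w' by (intro linear_between_diff[OF metric_linear[OF d]]) auto
  \<comment> \<open>Linearity is assumed in the second argument; symmetry carries it over to the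
    first.\<close>
  also have "\<dots> = g p w' (w' - w) - g p w (w' - w)"
    using w(1) w' d by (simp add: metric_sym)
  also have "\<dots> = 0" using w w' d by simp
  finally show "w' = w" using metric_pos[OF d] by (metis less_irrefl right_minus_eq)
qed (use w in blast)

text \<open>In a chart the gradient equation is a Riesz problem for the coordinate metric, so
  \<open>smooth_riesz\<close> yields existence and smoothness together, and uniqueness identifies
  its solution with the gradient. The second conclusion concerns the squared length.\<close>

lemma gradient_local:
  assumes c: "c \<in> A"
  shows "\<exists>Z. smooth_on (cimg c) Z \<and> smooth_on (cimg c) (\<lambda>x. D (h \<circ> cinv c) x (Z x)) \<and>
    (\<forall>x\<in>cimg c. coord_vector A c (cinv c x) (Z x) \<in> tangent_space A (cinv c x) \<and>
      gradient A g h (cinv c x) = coord_vector A c (cinv c x) (Z x) \<and>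
      (\<forall>v\<in>tangent_space A (cinv c x).
        g (cinv c x) (coord_vector A c (cinv c x) (Z x)) v = differential A h (cinv c x) v))"
proof -
  let ?e = "\<lambda>x. coord_vector A c (cinv c x)"
  let ?G = "\<lambda>x u v. g (cinv c x) (?e x u) (?e x v)"
  have cx: "c \<in> charts_at A (cinv c x)" if "x \<in> cimg c" for x
    using cinv_chart[OF c that] .
  have eT: "?e x u \<in> tangent_space A (cinv c x)" if "x \<in> cimg c" for x u
    using coord_vector_in[OF cx[OF that]] .
  have le: "linear (?e x)" if "x \<in> cimg c" for x
    using linear_coord_vector[OF cx[OF that]] .
  have smh: "smooth_on (cimg c) (h \<circ> cinv c)" using smooth_h c by (simp add: smooth_fun_def)
  have "\<exists>Z. smooth_on (cimg c) Z \<and> smooth_on (cimg c) (\<lambda>x. D (h \<circ> cinv c) x (Z x)) \<and>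
      (\<forall>x\<in>cimg c. \<forall>v. ?G x (Z x) v = D (h \<circ> cinv c) x v)"
  proof (rule smooth_riesz[OF open_cimg[OF c] finite_dim])
    show "linear (?G x u)" if x: "x \<in> cimg c" for x u
    proof (rule linearI)
      fix v w r
      have l: "linear_between (tangent_space A (cinv c x)) UNIV (g (cinv c x) (?e x u))"
        by (rule metric_linear[OF eT[OF x]])
      show "?G x u (v + w) = ?G x u v + ?G x u w"
        using l eT[OF x] by (simp add: linear_add[OF le[OF x]] linear_between_def)
      show "?G x u (r *\<^sub>R v) = r *\<^sub>R ?G x u v"
        using l eT[OF x] by (simp add: linear_cmul[OF le[OF x]] linear_between_def)
    qed
    show "?G x u v = ?G x v u" if "x \<in> cimg c" for x u v
      by (intro metric_sym eT that)
    show "?G x u u > 0" if x: "x \<in> cimg c" and u: "u \<noteq> 0" for x u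
    proof (rule metric_pos[OF eT[OF x]])
      show "?e x u \<noteq> 0"
      proof
        assume "?e x u = 0"
        then have "?e x u c = 0" by simp
        then show False using u by (simp add: coord_vector_self[OF cx[OF x]])
      qed
    qed
    show "smooth_on (cimg c) (\<lambda>x. ?G x u v)" for u v by (rule metric_smooth[OF c])
    show "linear (D (h \<circ> cinv c) x)" if "x \<in> cimg c" for x
      by (intro linear_frechet_derivative smooth_on_imp_differentiable[OF smh that])
    show "smooth_on (cimg c) (\<lambda>x. D (h \<circ> cinv c) x v)" for v by (rule smooth_on_D[OF smh])
  qed
  then obtain Z where Z: "smooth_on (cimg c) Z" "smooth_on (cimg c) (\<lambda>x. D (h \<circ> cinv c) x (Z x))"
    "\<And>x v. x \<in> cimg c \<Longrightarrow> ?G x (Z x) v = D (h \<circ> cinv c) x v"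
    by (elim exE conjE) (rule that; blast)
  have "g (cinv c x) (?e x (Z x)) v = differential A h (cinv c x) v"
    if x: "x \<in> cimg c" and v: "v \<in> tangent_space A (cinv c x)" for x v
    using Z(3)[OF x, of "v c"]
    by (simp add: coord_vector_component[OF v cx[OF x]] differential_eq[OF smooth_h cx[OF x] v] cmap_cinv[OF c x])
  note gr = this
  have "gradient A g h (cinv c x) = ?e x (Z x)" if x: "x \<in> cimg c" for x
    by (rule gradient_unique[OF eT[OF x] gr[OF x]])
  then show ?thesis
    by (intro exI[of _ Z] conjI ballI Z(1,2) eT gr)
qed

lemma gradient_in: "gradient A g h p \<in> tangent_space A p"
  and metric_gradient: "v \<in> tangent_space A p \<Longrightarrow> g p (gradient A g h p) v = differential A h p v"
proof -
  define c where "c = chart_at A p"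
  have c: "c \<in> A" "p \<in> cdom c" using chart_at_in[of p] by (auto simp: c_def charts_at_iff)
  have x: "cmap c p \<in> cimg c" "cinv c (cmap c p) = p" using c by (auto simp: cmap_in cinv_cmap)
  obtain Z where
    "\<forall>x\<in>cimg c. coord_vector A c (cinv c x) (Z x) \<in> tangent_space A (cinv c x) \<and>
      gradient A g h (cinv c x) = coord_vector A c (cinv c x) (Z x) \<and>
      (\<forall>v\<in>tangent_space A (cinv c x).
        g (cinv c x) (coord_vector A c (cinv c x) (Z x)) v = differential A h (cinv c x) v)"
    using gradient_local[OF c(1)] by (elim exE conjE) (rule that)
  from bspec[OF this x(1)]
  show "gradient A g h p \<in> tangent_space A p"
    and "v \<in> tangent_space A p \<Longrightarrow> g p (gradient A g h p) v = differential A h p v"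
    unfolding x(2) by auto
qed

definition gradient_norm2 :: "'m \<Rightarrow> real"
  where "gradient_norm2 p = g p (gradient A g h p) (gradient A g h p)"

lemma gradient_norm2_eq: "gradient_norm2 p = differential A h p (gradient A g h p)"
  by (simp add: gradient_norm2_def metric_gradient gradient_in)

text \<open>A zero gradient would represent the zero form on the tangent space; covectors are 0
  elsewhere by convention, so the differential itself would be 0.\<close>

lemma gradient_norm2_pos:
  assumes "\<not> critical_point A h p"
  shows "gradient_norm2 p > 0"
  unfolding gradient_norm2_def
proof (rule metric_pos[OF gradient_in])
  show "gradient A g h p \<noteq> 0"
  proof
    assume 0: "gradient A g h p = 0"
    have l: "linear_between (tangent_space A p) UNIV (g p v)" if "v \<in> tangent_space A p" for v
      by (rule metric_linear[OF that])
    have "differential A h p v = 0" for v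
    proof (cases "v \<in> tangent_space A p")
      case True
      have "differential A h p v = g p v 0"
        using metric_gradient[OF True] metric_sym[OF gradient_in True] 0 by simp
      also have "\<dots> = 0"
        using linear_between_diff[OF l[OF True] True True] by simp
      finally show ?thesis .
    next
      case False
      then show ?thesis using differential_in[OF smooth_h, of p] by (simp add: cotangent_space_def)
    qed
    then have "critical_point A h p" by (simp add: critical_point_def fun_eq_iff)
    then show False using assms by blast
  qed
qed

definition normalized_gradient :: "'m \<Rightarrow> ('m, 'e) tvec"
  where "normalized_gradient p = (1 / gradient_norm2 p) *\<^sub>R gradient A g h p"

lemma normalized_gradient_in: "normalized_gradient p \<in> tangent_space A p"
  unfolding normalized_gradient_def by (intro subspace_scale subspace_tangent_space gradient_in)

lemma differential_normalized_gradient: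
  assumes "\<not> critical_point A h p"
  shows "differential A h p (normalized_gradient p) = 1"
  using gradient_norm2_pos[OF assms]
  by (simp add: normalized_gradient_def cotangent_scale[OF differential_in[OF smooth_h] gradient_in]
      gradient_norm2_eq[symmetric])

lemma vector_field_normalized_gradient:
  assumes "\<And>p. \<not> critical_point A h p"
  shows "vector_field A normalized_gradient"
  unfolding vector_field_def
proof (intro conjI allI ballI normalized_gradient_in)
  fix c assume c: "c \<in> A"
  obtain Z where Z: "smooth_on (cimg c) Z" "smooth_on (cimg c) (\<lambda>x. D (h \<circ> cinv c) x (Z x))"
    "\<And>x. x \<in> cimg c \<Longrightarrow> gradient A g h (cinv c x) = coord_vector A c (cinv c x) (Z x)"
    using gradient_local[OF c] by (elim exE conjE) (rule that; blast)
  have grad: "gradient A g h (cinv c x) c = Z x" if "x \<in> cimg c" for x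
    using Z(3)[OF that] coord_vector_self[OF cinv_chart[OF c that]] by simp
  \<comment> \<open>The squared length is \<open>dh\<close> of the gradient, a function already
    known to be smooth in the chart.\<close>
  have n: "gradient_norm2 (cinv c x) = D (h \<circ> cinv c) x (Z x)" if "x \<in> cimg c" for x
    by (simp add: gradient_norm2_eq differential_eq[OF smooth_h cinv_chart[OF c that] gradient_in]
        grad[OF that] cmap_cinv[OF c that])
  have "D (h \<circ> cinv c) x (Z x) \<noteq> 0" if "x \<in> cimg c" for x
    using n[OF that] gradient_norm2_pos[OF assms, of "cinv c x"] by simp
  then have "smooth_on (cimg c) (\<lambda>x. (1 / D (h \<circ> cinv c) x (Z x)) *\<^sub>R Z x)"
    using Z(1,2) by (intro smooth_on_scaleR smooth_on_divide open_cimg c smooth_on_const)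
  then show "smooth_on (cimg c) (\<lambda>x. normalized_gradient (cinv c x) c)"
    by (subst smooth_on_cong[OF open_cimg[OF c], where g = "\<lambda>x. (1 / D (h \<circ> cinv c) x (Z x)) *\<^sub>R Z x"])
      (auto simp: normalized_gradient_def n grad)
qed

end

section \<open>Invariant fields of a smooth action\<close>

lemma D_affine:
  assumes "bounded_linear L" "f differentiable (at (c + L y))"
  shows "D (\<lambda>y. f (c + L y)) y v = D f (c + L y) (L v)"
proof -
  have "((\<lambda>y. c + L y) has_derivative L) (at y)"
    using bounded_linear_imp_has_derivative[OF assms(1)] by (auto intro!: derivative_eq_intros)
  from has_derivative_compose[OF this has_derivative_D[OF assms(2)]] show ?thesis
    by (simp add: D_eqI)
qed

lemma bounded_linear_Pair_left: "bounded_linear (\<lambda>t. (t, 0))"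
  and bounded_linear_Pair_right: "bounded_linear (\<lambda>y. (0, y))"
  by (intro bounded_linear_Pair bounded_linear_ident bounded_linear_zero)+

locale lie_group_action = G: manifold AG + M: manifold AM
  for AG :: "('g::{t2_space,second_countable_topology}, 'f::real_normed_vector) chart set"
    and AM :: "('m::{t2_space,second_countable_topology}, 'e::real_normed_vector) chart set" +
  fixes gmul :: "'g \<Rightarrow> 'g \<Rightarrow> 'g" and e :: 'g and inverse_G :: "'g \<Rightarrow> 'g" and \<Phi> :: "'g \<Rightarrow> 'm \<Rightarrow> 'm"
  assumes group: "Groups.group gmul e inverse_G"
    and action: "smooth_action AG gmul e AM \<Phi>"
begin

lemma action_neutral: "\<Phi> e x = x"
  using action by (simp add: smooth_action_def)

lemma action_inverse: "\<Phi> (inverse_G a) (\<Phi> a x) = x" "\<Phi> a (\<Phi> (inverse_G a) x) = x"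
proof -
  have "\<Phi> (gmul a b) x = \<Phi> a (\<Phi> b x)" for a b x
    using action by (simp add: smooth_action_def)
  then show "\<Phi> (inverse_G a) (\<Phi> a x) = x" "\<Phi> a (\<Phi> (inverse_G a) x) = x"
    by (metis group group.left_inverse action_neutral, metis group group.right_inverse action_neutral)
qed

lemma continuous_action: "continuous_on UNIV (\<lambda>z. \<Phi> (fst z) (snd z))"
  using action by (simp add: smooth_action_def smooth_map_def case_prod_unfold)

section \<open>The action in charts\<close>

text \<open>One function on an open subset of a product of normed spaces: translations and orbit
  maps are its slices, generators its partial derivatives.\<close>

definition coord_action ::
    "('g, 'f) chart \<Rightarrow> ('m, 'e) chart \<Rightarrow> ('m, 'e) chart \<Rightarrow> 'f \<times> 'e \<Rightarrow> 'e"
  where "coord_action c0 c d z = cmap d (\<Phi> (cinv c0 (fst z)) (cinv c (snd z)))"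

definition coord_action_dom ::
    "('g, 'f) chart \<Rightarrow> ('m, 'e) chart \<Rightarrow> ('m, 'e) chart \<Rightarrow> ('f \<times> 'e) set"
  where "coord_action_dom c0 c d =
    {z. fst z \<in> cimg c0 \<and> snd z \<in> cimg c \<and> \<Phi> (cinv c0 (fst z)) (cinv c (snd z)) \<in> cdom d}"

lemma open_coord_action_dom:
  assumes c: "c0 \<in> AG" "c \<in> AM" "d \<in> AM"
  shows "open (coord_action_dom c0 c d)"
proof -
  have ci: "continuous_on (cimg c0) (cinv c0)" "continuous_on (cimg c) (cinv c)"
    using G.homeomorphism_chart[OF c(1)] M.homeomorphism_chart[OF c(2)] by (simp_all add: homeomorphism_def)
  have "continuous_on (cimg c0 \<times> cimg c) (\<lambda>z. (cinv c0 (fst z), cinv c (snd z)))"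
    by (intro continuous_on_Pair continuous_on_compose2[OF ci(1)] continuous_on_compose2[OF ci(2)]
        continuous_on_fst continuous_on_snd continuous_on_id) auto
  from continuous_on_compose2[OF continuous_action this]
  have "continuous_on (cimg c0 \<times> cimg c) (\<lambda>z. \<Phi> (cinv c0 (fst z)) (cinv c (snd z)))"
    by simp
  then have "open ((cimg c0 \<times> cimg c) \<inter> (\<lambda>z. \<Phi> (cinv c0 (fst z)) (cinv c (snd z))) -` cdom d)"
    by (intro continuous_open_preimage open_Times G.open_cimg M.open_cimg M.open_cdom c)
  also have "(cimg c0 \<times> cimg c) \<inter> (\<lambda>z. \<Phi> (cinv c0 (fst z)) (cinv c (snd z))) -` cdom d
      = coord_action_dom c0 c d"
    by (auto simp: coord_action_dom_def)
  finally show ?thesis .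
qed

text \<open>The inverse of a product chart is a choice of preimages; injectivity identifies it, on
  chart images, with the pair of inverses, and smoothness in the product atlas carries over.\<close>

lemma smooth_coord_action:
  assumes c: "c0 \<in> AG" "c \<in> AM" "d \<in> AM"
  shows "smooth_on (coord_action_dom c0 c d) (coord_action c0 c d)"
proof -
  define k where "k = (cdom c0 \<times> cdom c, map_prod (cmap c0) (cmap c))"
  have k: "k \<in> product_atlas AG AM" 
    unfolding k_def product_atlas_def using c by blast
  have inj: "inj_on (cmap c0) (cdom c0)" "inj_on (cmap c) (cdom c)"
    using c by (metis inj_on_inverseI G.cinv_cmap, metis inj_on_inverseI M.cinv_cmap)
  have cinv_k: "cinv k = inv_into (cdom c0 \<times> cdom c) (map_prod (cmap c0) (cmap c))"
    by (subst cinv_def) (simp add: k_def)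
  have inv: "cinv k z = (cinv c0 (fst z), cinv c (snd z))" if "fst z \<in> cimg c0" "snd z \<in> cimg c" for z
    unfolding cinv_k
  proof (rule inv_into_f_eq)
    show "inj_on (map_prod (cmap c0) (cmap c)) (cdom c0 \<times> cdom c)"
      using inj by (rule map_prod_inj_on)
  qed (use that c in \<open>auto simp: G.cinv_in M.cinv_in G.cmap_cinv M.cmap_cinv\<close>)
  have dom: "cmap k ` (cdom k \<inter> (\<lambda>(a, x). \<Phi> a x) -` cdom d) = coord_action_dom c0 c d"
  proof
    show "cmap k ` (cdom k \<inter> (\<lambda>(a, x). \<Phi> a x) -` cdom d) \<subseteq> coord_action_dom c0 c d"
      using c by (auto simp: k_def coord_action_dom_def cimg_def G.cinv_cmap M.cinv_cmap)
    show "coord_action_dom c0 c d \<subseteq> cmap k ` (cdom k \<inter> (\<lambda>(a, x). \<Phi> a x) -` cdom d)"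
    proof
      fix z assume "z \<in> coord_action_dom c0 c d"
      then have "z = cmap k (cinv c0 (fst z), cinv c (snd z))"
        "(cinv c0 (fst z), cinv c (snd z)) \<in> cdom k \<inter> (\<lambda>(a, x). \<Phi> a x) -` cdom d"
        using c by (auto simp: k_def coord_action_dom_def G.cinv_in M.cinv_in G.cmap_cinv M.cmap_cinv)
      then show "z \<in> cmap k ` (cdom k \<inter> (\<lambda>(a, x). \<Phi> a x) -` cdom d)" by (rule image_eqI)
    qed
  qed
  have "smooth_on (cmap k ` (cdom k \<inter> (\<lambda>(a, x). \<Phi> a x) -` cdom d)) (cmap d \<circ> (\<lambda>(a, x). \<Phi> a x) \<circ> cinv k)"
    using action k c(3) unfolding smooth_action_def smooth_map_def by blast
  then show ?thesis
    unfolding dom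
    by (subst smooth_on_cong[OF open_coord_action_dom[OF c], where g = "cmap d \<circ> (\<lambda>(a, x). \<Phi> a x) \<circ> cinv k"])
      (auto simp: coord_action_dom_def coord_action_def inv)
qed

lemma smooth_map_action: "smooth_map AM AM (\<Phi> a)"
  unfolding smooth_map_def
proof (intro conjI ballI)
  show cont: "continuous_on UNIV (\<Phi> a)"
    using continuous_on_compose2[OF continuous_action, of UNIV "\<lambda>x. (a, x)"]
    by (simp add: continuous_on_Pair)
  fix c d assume cd: "c \<in> AM" "d \<in> AM"
  define c0 where "c0 = chart_at AG a"
  have c0: "c0 \<in> AG" "a \<in> cdom c0" using G.chart_at_in[of a] by (auto simp: c0_def G.charts_at_iff)
  let ?U = "cmap c ` (cdom c \<inter> \<Phi> a -` cdom d)"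
  have U: "open ?U"
    using cont by (intro M.open_chart_image cd open_vimage M.open_cdom)
  \<comment> \<open>In charts \<open>\<Phi> a\<close> is the slice with the group coordinate frozen
    at \<open>cmap c0 a\<close>.\<close>
  have "smooth_on ?U (\<lambda>y. coord_action c0 c d ((cmap c0 a, 0) + (0, y)))"
    by (rule smooth_on_affine[OF open_coord_action_dom[OF c0(1) cd] U bounded_linear_Pair_right _
          smooth_coord_action[OF c0(1) cd]])
      (use c0 cd in \<open>auto simp: coord_action_dom_def G.cmap_in M.cmap_in G.cinv_cmap M.cinv_cmap\<close>)
  then show "smooth_on ?U (cmap d \<circ> \<Phi> a \<circ> cinv c)"
    by (simp add: coord_action_def G.cinv_cmap[OF c0] comp_def)
qed

lemma smooth_map_orbit: "smooth_map AG AM (\<lambda>a. \<Phi> a x)"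
  unfolding smooth_map_def
proof (intro conjI ballI)
  show cont: "continuous_on UNIV (\<lambda>a. \<Phi> a x)"
    using continuous_on_compose2[OF continuous_action, of UNIV "\<lambda>a. (a, x)"]
    by (simp add: continuous_on_Pair)
  fix c0 d assume cd: "c0 \<in> AG" "d \<in> AM"
  define c where "c = chart_at AM x"
  have c: "c \<in> AM" "x \<in> cdom c" using M.chart_at_in[of x] by (auto simp: c_def M.charts_at_iff)
  let ?U = "cmap c0 ` (cdom c0 \<inter> (\<lambda>a. \<Phi> a x) -` cdom d)"
  have U: "open ?U"
    using cont by (intro G.open_chart_image cd open_vimage M.open_cdom)
  have "smooth_on ?U (\<lambda>t. coord_action c0 c d ((0, cmap c x) + (t, 0)))"
    by (rule smooth_on_affine[OF open_coord_action_dom[OF cd(1) c(1) cd(2)] U bounded_linear_Pair_left _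
          smooth_coord_action[OF cd(1) c(1) cd(2)]])
      (use c cd in \<open>auto simp: coord_action_dom_def G.cmap_in M.cmap_in G.cinv_cmap M.cinv_cmap\<close>)
  then show "smooth_on ?U (cmap d \<circ> (\<lambda>a. \<Phi> a x) \<circ> cinv c0)"
    by (simp add: coord_action_def M.cinv_cmap[OF c] comp_def)
qed

section \<open>Infinitesimal generators\<close>

abbreviation generator :: "('g, 'f) tvec \<Rightarrow> 'm \<Rightarrow> ('m, 'e) tvec"
  where "generator \<equiv> infinitesimal_generator AG e AM \<Phi>"

lemma generator_in: "generator \<xi> x \<in> tangent_space AM x"
  using tangent_map_in[OF G.manifold_axioms M.manifold_axioms smooth_map_orbit[of x], of e \<xi>]
  by (simp add: infinitesimal_generator_def action_neutral)

lemma linear_generator: "linear (\<lambda>\<xi>. generator \<xi> x)"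
  unfolding infinitesimal_generator_def
  by (rule linear_tangent_map[OF G.manifold_axioms M.manifold_axioms smooth_map_orbit])

text \<open>\<open>h\<close> is constant along each orbit, so its derivative in the group variable
  vanishes.\<close>

lemma differential_generator:
  assumes h: "smooth_fun AM h" "invariant_fun \<Phi> h" and \<xi>: "\<xi> \<in> tangent_space AG e"
  shows "differential AM h x (generator \<xi> x) = 0"
proof -
  let ?c0 = "chart_at AG e"
  have "h \<circ> (\<lambda>a. \<Phi> a x) \<circ> cinv ?c0 = (\<lambda>t. h x)"
    using h(2) by (simp add: invariant_fun_def comp_def)
  then show ?thesis
    using differential_tangent_map[OF G.manifold_axioms M.manifold_axioms smooth_map_orbit[of x] h(1) G.chart_at_in \<xi>]
    by (simp add: infinitesimal_generator_def action_neutral)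
qed

lemma coord_action_differentiable:
  assumes c: "c0 \<in> AG" "c \<in> AM" "d \<in> AM" and z: "z \<in> coord_action_dom c0 c d"
  shows "coord_action c0 c d differentiable (at z)"
    and "(\<lambda>z. D (coord_action c0 c d) z u) differentiable (at z)"
  using smooth_on_imp_differentiable[OF _ z] smooth_coord_action[OF c] smooth_on_D by blast+

text \<open>Turns a derivative taken separately for each point into a partial derivative of one
  smooth function, which makes it smooth in \<open>y\<close>.\<close>

lemma generator_coord:
  assumes c: "c \<in> AM" and y: "y \<in> cimg c"
  shows "generator \<xi> (cinv c y) c =
    D (coord_action (chart_at AG e) c c) (cmap (chart_at AG e) e, y) (\<xi> (chart_at AG e), 0)"
proof -
  define c0 where "c0 = chart_at AG e"
  have c0: "c0 \<in> AG" "e \<in> cdom c0" using G.chart_at_in[of e] by (auto simp: c0_def G.charts_at_iff)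
  \<comment> \<open>The point \<open>(cmap c0 e, y)\<close> split into a fixed point and the
    embedded variable, as \<open>D_affine\<close> expects.\<close>
  have z: "(0, y) + (cmap c0 e, 0) \<in> coord_action_dom c0 c c"
    using c0 c y by (simp add: coord_action_dom_def G.cmap_in G.cinv_cmap action_neutral M.cinv_in)
  have "cmap c \<circ> (\<lambda>a. \<Phi> a (cinv c y)) \<circ> cinv c0 = (\<lambda>t. coord_action c0 c c ((0, y) + (t, 0)))"
    by (simp add: coord_action_def comp_def)
  then show ?thesis
    using D_affine[OF bounded_linear_Pair_left coord_action_differentiable(1)[OF c0(1) c c z], of "\<xi> c0"]
    by (simp add: infinitesimal_generator_def tangent_map_def Let_def action_neutral M.cinv_chart[OF c y]
        c0_def[symmetric])
qed

lemma vector_field_generator: "vector_field AM (generator \<xi>)"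
  unfolding vector_field_def
proof (intro conjI allI ballI generator_in)
  fix c assume c: "c \<in> AM"
  define c0 where "c0 = chart_at AG e"
  have c0: "c0 \<in> AG" "e \<in> cdom c0" using G.chart_at_in[of e] by (auto simp: c0_def G.charts_at_iff)
  have "smooth_on (cimg c) (\<lambda>y. D (coord_action c0 c c) ((cmap c0 e, 0) + (0, y)) (\<xi> c0, 0))"
    by (rule smooth_on_affine[OF open_coord_action_dom[OF c0(1) c c] M.open_cimg[OF c] bounded_linear_Pair_right _
          smooth_on_D[OF smooth_coord_action[OF c0(1) c c]]])
      (use c0 c in \<open>auto simp: coord_action_dom_def G.cmap_in G.cinv_cmap action_neutral M.cinv_in\<close>)
  then show "smooth_on (cimg c) (\<lambda>y. generator \<xi> (cinv c y) c)"
    by (subst smooth_on_cong[OF M.open_cimg[OF c]]) (simp_all add: generator_coord[OF c] c0_def)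
qed

text \<open>Differentiating \<open>Y (\<Phi> a p) = T \<Phi>\<^sub>a (Y p)\<close> in \<open>a\<close> at \<open>e\<close> gives \<open>DY (\<xi>\<^sub>M)\<close> on the left and a mixed
  second derivative of the action on the right, which by symmetry is \<open>D\<xi>\<^sub>M (Y)\<close>; no flows are needed.\<close>

lemma invariant_field_commutes_with_generator:
  assumes Y: "vector_field AM Y"
    and equiv: "\<And>a x. Y (\<Phi> a x) = tangent_map AM AM (\<Phi> a) x (Y x)"
  shows "let c = chart_at AM p in
    D (\<lambda>x. Y (cinv c x) c) (cmap c p) (generator \<xi> p c) = D (\<lambda>x. generator \<xi> (cinv c x) c) (cmap c p) (Y p c)"
proof -
  define c where "c = chart_at AM p"
  have c: "c \<in> AM" "p \<in> cdom c" using M.chart_at_in[of p] by (auto simp: c_def M.charts_at_iff)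
  define c0 where "c0 = chart_at AG e"
  have c0: "c0 \<in> AG" "e \<in> cdom c0" using G.chart_at_in[of e] by (auto simp: c0_def G.charts_at_iff)
  define y where "y = cmap c p"
  have y: "y \<in> cimg c" "cinv c y = p" using c by (simp_all add: y_def M.cmap_in M.cinv_cmap)
  define s where "s = cmap c0 e"
  define \<tau> where "\<tau> = \<xi> c0"
  define F where "F = coord_action c0 c c"
  define W where "W = coord_action_dom c0 c c"
  define Yc where "Yc x = Y (cinv c x) c" for x
  define Xc where "Xc x = generator \<xi> (cinv c x) c" for x
  have W: "open W" unfolding W_def by (rule open_coord_action_dom[OF c0(1) c(1) c(1)])
  have z: "(s, y) \<in> W"
    using c0 c y by (simp add: W_def s_def coord_action_dom_def G.cmap_in G.cinv_cmap action_neutral)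
  have F: "F differentiable (at z)" "(\<lambda>z. D F z u) differentiable (at z)" if "z \<in> W" for z u
    using coord_action_differentiable[OF c0(1) c(1) c(1)] that by (simp_all add: F_def W_def)
  have Xc: "Xc x = D F (s, x) (\<tau>, 0)" if "x \<in> cimg c" for x
    using generator_coord[OF c(1) that, of \<xi>] by (simp add: Xc_def F_def s_def \<tau>_def c0_def)
  have "smooth_on (cimg c) Yc" using Y c(1) by (simp add: vector_field_def Yc_def[abs_def])
  then have dY: "Yc differentiable (at y)" using y(1) by (rule smooth_on_imp_differentiable)
  \<comment> \<open>Equivariance at the group element \<open>cinv c0 t\<close>, read in the chart:
    \<open>Y\<close> at the moved point equals the point derivative of the action applied to
    \<open>Y\<close>.\<close>
  have along: "Yc (F ((0, y) + (t, 0))) = D F ((0, y) + (t, 0)) (0, Yc y)" if "(t, y) \<in> W" for t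
  proof -
    define a where "a = cinv c0 t"
    have ap: "\<Phi> a p \<in> cdom c" using that by (simp add: W_def coord_action_dom_def a_def y(2))
    have "D (\<lambda>x. F ((t, 0) + (0, x))) y (Yc y) = D F ((t, 0) + (0, y)) (0, Yc y)"
      by (rule D_affine[OF bounded_linear_Pair_right]) (use F(1)[OF that] in simp)
    moreover have "cmap c \<circ> \<Phi> a \<circ> cinv c = (\<lambda>x. F ((t, 0) + (0, x)))"
      by (simp add: F_def coord_action_def a_def comp_def)
    ultimately have "tangent_map AM AM (\<Phi> a) p (Y p) c = D F (t, y) (0, Yc y)"
      using ap c(1) by (simp add: tangent_map_def Let_def c_def[symmetric] M.charts_at_iff y_def[symmetric] Yc_def y(2))
    moreover have "Yc (F (t, y)) = Y (\<Phi> a p) c"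
      using ap c(1) by (simp add: Yc_def F_def coord_action_def a_def[symmetric] y(2) M.cinv_cmap)
    ultimately show ?thesis by (simp add: equiv)
  qed
  \<comment> \<open>Open set of group coordinates on which \<open>along\<close> holds; it contains
    \<open>s\<close>, so both sides have the same derivative there.\<close>
  define T where "T = (\<lambda>t. (t, y)) -` W"
  have T: "open T" unfolding T_def by (intro open_vimage W continuous_intros)
  have "D (\<lambda>t. Yc (F ((0, y) + (t, 0)))) s \<tau> = D (\<lambda>t. D F ((0, y) + (t, 0)) (0, Yc y)) s \<tau>"
    using D_cong[OF T, of s "\<lambda>t. Yc (F ((0, y) + (t, 0)))" "\<lambda>t. D F ((0, y) + (t, 0)) (0, Yc y)"] along z
    by (simp add: T_def)
  \<comment> \<open>At \<open>s\<close> the orbit passes through \<open>y\<close> with velocity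
    \<open>Xc y\<close>.\<close>
  moreover have "D (\<lambda>t. Yc (F ((0, y) + (t, 0)))) s \<tau> = D Yc y (Xc y)"
  proof -
    have Fz: "F (s, y) = y"
      using c0 c y by (simp add: F_def coord_action_def s_def G.cinv_cmap action_neutral M.cmap_cinv[symmetric] y_def)
    have "(Yc \<circ> F has_derivative D Yc y \<circ> D F (s, y)) (at (s, y))"
      by (rule diff_chain_at[OF has_derivative_D[OF F(1)[OF z]]]) (use has_derivative_D[OF dY] Fz in simp)
    then have "Yc \<circ> F differentiable (at ((0, y) + (s, 0)))" "D (Yc \<circ> F) (s, y) = D Yc y \<circ> D F (s, y)"
      by (auto simp: differentiable_def D_eqI)
    from D_affine[OF bounded_linear_Pair_left this(1), of \<tau>] this(2) show ?thesis
      by (simp add: Xc[OF y(1)] comp_def)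
  qed
  moreover have "D (\<lambda>t. D F ((0, y) + (t, 0)) (0, Yc y)) s \<tau> = D (\<lambda>z. D F z (0, Yc y)) (s, y) (\<tau>, 0)"
    using D_affine[OF bounded_linear_Pair_left, of "\<lambda>z. D F z (0, Yc y)" "(0, y)" s \<tau>] F(2)[OF z] by simp
  \<comment> \<open>Interchanges the group direction \<open>(\<tau>, 0)\<close> and the point
    direction \<open>(0, Yc y)\<close>.\<close>
  moreover have "\<dots> = D (\<lambda>z. D F z (\<tau>, 0)) (s, y) (0, Yc y)"
    by (rule second_derivative_symmetric[OF W z F(1) F(2)[OF z] F(2)[OF z]])
  \<comment> \<open>Now the group coordinate is frozen at \<open>s\<close>, where the group
    derivative of \<open>F\<close> is the generator.\<close>
  moreover have "D Xc y (Yc y) = D (\<lambda>z. D F z (\<tau>, 0)) (s, y) (0, Yc y)"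
  proof -
    have "D Xc y = D (\<lambda>x. D F ((s, 0) + (0, x)) (\<tau>, 0)) y"
      by (rule D_cong[OF M.open_cimg[OF c(1)] y(1)]) (simp add: Xc)
    then show ?thesis
      using D_affine[OF bounded_linear_Pair_right, of "\<lambda>z. D F z (\<tau>, 0)" "(s, 0)" y "Yc y"] F(2)[OF z] by simp
  qed
  ultimately have "D Yc y (Xc y) = D Xc y (Yc y)" by simp
  then show ?thesis
    by (simp add: Let_def c_def[symmetric] y_def[symmetric] Yc_def[abs_def] Xc_def[abs_def] y(2))
qed

end

section \<open>Equivariance of the gradient\<close>

locale invariant_riemannian = lie_group_action AG AM gmul e inverse_G \<Phi> + riemannian AM g h
  for AG :: "('g::{t2_space,second_countable_topology}, 'f::real_normed_vector) chart set"
    and AM :: "('m::{t2_space,second_countable_topology}, 'e::real_normed_vector) chart set"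
    and gmul :: "'g \<Rightarrow> 'g \<Rightarrow> 'g" and e :: 'g and inverse_G :: "'g \<Rightarrow> 'g" and \<Phi> :: "'g \<Rightarrow> 'm \<Rightarrow> 'm"
    and g :: "'m \<Rightarrow> ('m, 'e) tvec \<Rightarrow> ('m, 'e) tvec \<Rightarrow> real" and h :: "'m \<Rightarrow> real" +
  assumes invariant_h: "invariant_fun \<Phi> h" and invariant_g: "invariant_metric AM \<Phi> g"
begin

abbreviation pushforward :: "'g \<Rightarrow> 'm \<Rightarrow> ('m, 'e) tvec \<Rightarrow> ('m, 'e) tvec"
  where "pushforward a \<equiv> tangent_map AM AM (\<Phi> a)"

lemma pushforward_in: "pushforward a x v \<in> tangent_space AM (\<Phi> a x)"
  by (rule tangent_map_in[OF M.manifold_axioms M.manifold_axioms smooth_map_action])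

text \<open>Pushing forward by the inverse element gives the preimage. Needed since the gradient at
  \<open>\<Phi> a x\<close> is tested against all tangent vectors there.\<close>

lemma pushforward_surj:
  assumes v: "v \<in> tangent_space AM (\<Phi> a x)"
  obtains u where "u \<in> tangent_space AM x" "v = pushforward a x u"
proof -
  let ?b = "inverse_G a"
  let ?u = "pushforward ?b (\<Phi> a x) v"
  have "pushforward a (\<Phi> ?b (\<Phi> a x)) ?u = tangent_map AM AM (\<Phi> a \<circ> \<Phi> ?b) (\<Phi> a x) v"
    by (rule tangent_map_comp[OF M.manifold_axioms M.manifold_axioms M.manifold_axioms
          smooth_map_action smooth_map_action v])
  moreover have "\<Phi> a \<circ> \<Phi> ?b = id" by (simp add: fun_eq_iff action_inverse)
  ultimately have "v = pushforward a x ?u"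
    using M.tangent_map_id[OF v] by (simp add: action_inverse)
  moreover have "?u \<in> tangent_space AM x" using pushforward_in[of ?b "\<Phi> a x" v] by (simp add: action_inverse)
  ultimately show ?thesis using that by blast
qed

lemma metric_pushforward:
  "u \<in> tangent_space AM x \<Longrightarrow> v \<in> tangent_space AM x \<Longrightarrow>
    g (\<Phi> a x) (pushforward a x u) (pushforward a x v) = g x u v"
  using invariant_g by (simp add: invariant_metric_def)

text \<open>The pushed-forward gradient satisfies the equation that determines the gradient at
  \<open>\<Phi> a x\<close>: test vectors are pushforwards, and both \<open>g\<close> and
  \<open>dh\<close> are preserved.\<close>

lemma gradient_equivariant: "gradient AM g h (\<Phi> a x) = pushforward a x (gradient AM g h x)"
proof (rule gradient_unique[OF pushforward_in])
  fix v assume "v \<in> tangent_space AM (\<Phi> a x)"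
  then obtain u where u: "u \<in> tangent_space AM x" "v = pushforward a x u"
    by (rule pushforward_surj)
  have "h \<circ> \<Phi> a = h" using invariant_h by (simp add: invariant_fun_def fun_eq_iff)
  then have "differential AM h (\<Phi> a x) v = differential AM h x u"
    using differential_tangent_map[OF M.manifold_axioms M.manifold_axioms smooth_map_action smooth_h M.chart_at_in u(1), of a]
      M.differential_eq[OF smooth_h M.chart_at_in u(1)]
    by (simp add: u(2))
  then show "g (\<Phi> a x) (pushforward a x (gradient AM g h x)) v = differential AM h (\<Phi> a x) v"
    using metric_gradient[OF u(1)] by (simp add: u(2) metric_pushforward gradient_in u(1))
qed

lemma normalized_gradient_equivariant:
  "normalized_gradient (\<Phi> a x) = pushforward a x (normalized_gradient x)"
proof -
  have "gradient_norm2 (\<Phi> a x) = gradient_norm2 x"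
    by (simp add: gradient_norm2_def gradient_equivariant metric_pushforward gradient_in)
  then show ?thesis
    using linear_cmul[OF linear_tangent_map[OF M.manifold_axioms M.manifold_axioms smooth_map_action]]
    by (simp add: normalized_gradient_def gradient_equivariant)
qed

section \<open>The bivectors attached to Lie algebra elements\<close>

lemma pi_xi_eq:
  "pi_xi AG e AM \<Phi> g h \<xi> = (\<lambda>x. wedge AM x (normalized_gradient x) (generator \<xi> x))"
  by (simp add: fun_eq_iff pi_xi_def normalized_gradient_def gradient_norm2_def)

lemma pi_xi_add: "pi_xi AG e AM \<Phi> g h (\<xi> + \<eta>) = pi_xi AG e AM \<Phi> g h \<xi> + pi_xi AG e AM \<Phi> g h \<eta>"
  unfolding pi_xi_eq
proof (intro ext)
  fix x \<alpha> \<beta>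
  let ?w = "\<lambda>X. wedge AM x (normalized_gradient x) X \<alpha> \<beta>"
  have "?w (generator (\<xi> + \<eta>) x) = ?w (generator \<xi> x) + ?w (generator \<eta> x)"
    by (auto simp: wedge_def linear_add[OF linear_generator] M.cotangent_add[where p = x] generator_in algebra_simps)
  then show "?w (generator (\<xi> + \<eta>) x) =
    ((\<lambda>x. wedge AM x (normalized_gradient x) (generator \<xi> x)) +
      (\<lambda>x. wedge AM x (normalized_gradient x) (generator \<eta> x))) x \<alpha> \<beta>" by simp
qed

lemma pi_xi_scale: "pi_xi AG e AM \<Phi> g h (r *\<^sub>R \<xi>) = r *\<^sub>R pi_xi AG e AM \<Phi> g h \<xi>"
  unfolding pi_xi_eq
proof (intro ext)
  fix x \<alpha> \<beta>
  let ?w = "\<lambda>X. wedge AM x (normalized_gradient x) X \<alpha> \<beta>"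
  have "?w (generator (r *\<^sub>R \<xi>) x) = r *\<^sub>R ?w (generator \<xi> x)"
    by (auto simp: wedge_def linear_cmul[OF linear_generator] M.cotangent_scale[where p = x] generator_in algebra_simps)
  then show "?w (generator (r *\<^sub>R \<xi>) x) =
    (r *\<^sub>R (\<lambda>x. wedge AM x (normalized_gradient x) (generator \<xi> x))) x \<alpha> \<beta>" by simp
qed

text \<open>Linear on all chart-indexed families, not just on the Lie algebra, because the generator
  depends on \<open>\<xi>\<close> only through its component at \<open>chart_at AG e\<close>. Hence
  the image of the Lie algebra is a subspace by the general fact on linear images.\<close>

lemma linear_pi_xi: "linear (pi_xi AG e AM \<Phi> g h)"
  by (rule linearI) (rule pi_xi_add pi_xi_scale)+

lemma poisson_structure_pi_xi:
  assumes "\<And>x. \<not> critical_point AM h x"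
  shows "poisson_structure AM (pi_xi AG e AM \<Phi> g h \<xi>)"
  unfolding pi_xi_eq
  by (intro M.poisson_structure_commuting vector_field_normalized_gradient vector_field_generator
      invariant_field_commutes_with_generator normalized_gradient_equivariant assms)

lemma rank_pi_xi: "bivector_rank AM x (pi_xi AG e AM \<Phi> g h \<xi> x) \<le> 2"
  unfolding pi_xi_eq by (rule M.rank_wedge[OF normalized_gradient_in generator_in])

lemma sharp_pi_xi:
  assumes "\<And>x. \<not> critical_point AM h x" "\<xi> \<in> tangent_space AG e"
  shows "sharp AM x (pi_xi AG e AM \<Phi> g h \<xi> x) (differential AM h x) = generator \<xi> x"
  unfolding pi_xi_eq
  by (simp add: M.sharp_wedge normalized_gradient_in generator_in M.differential_in smooth_h
      differential_normalized_gradient assms differential_generator invariant_h)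

end

theorem proposition4p27:
  fixes AG :: "('g::{t2_space,second_countable_topology}, 'f::real_normed_vector) chart set"
    and gmul :: "'g \<Rightarrow> 'g \<Rightarrow> 'g" and e :: 'g and inverse_G :: "'g \<Rightarrow> 'g"
    and AM :: "('m::{t2_space,second_countable_topology}, 'e::real_normed_vector) chart set"
    and \<Phi> :: "'g \<Rightarrow> 'm \<Rightarrow> 'm"
    and h :: "'m \<Rightarrow> real"
    and g :: "'m \<Rightarrow> ('m, 'e) tvec \<Rightarrow> ('m, 'e) tvec \<Rightarrow> real"
  assumes "lie_group AG gmul e inverse_G"
    and "smooth_manifold AM"
    and "smooth_action AG gmul e AM \<Phi>"
    and "proper_action \<Phi>"
    and "smooth_fun AM h"
    and "invariant_fun \<Phi> h"
    and "\<forall>x. \<not> critical_point AM h x"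
    and "riemannian_metric AM g"
    and "invariant_metric AM \<Phi> g"
  shows "\<exists>V. subspace V \<and>
           (\<forall>P\<in>V. poisson_structure AM P \<and> (\<forall>x. bivector_rank AM x (P x) \<le> 2)) \<and>
           linear_between (lie_algebra AG e) V (pi_xi AG e AM \<Phi> g h) \<and>
           (\<forall>\<xi>\<in>lie_algebra AG e. \<forall>x.
              sharp AM x (pi_xi AG e AM \<Phi> g h \<xi> x) (differential AM h x)
                = infinitesimal_generator AG e AM \<Phi> \<xi> x)"
proof -
  interpret invariant_riemannian AG AM gmul e inverse_G \<Phi> g h
    by (intro invariant_riemannian.intro lie_group_action.intro lie_group_action_axioms.intro manifold.intro
        riemannian.intro riemannian_axioms.intro invariant_riemannian_axioms.intro)
      (use assms in \<open>simp_all add: lie_group_def\<close>)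
  let ?L = "lie_algebra AG e"
  let ?\<pi> = "pi_xi AG e AM \<Phi> g h"
  have nc: "\<And>x. \<not> critical_point AM h x" using assms(7) by blast
  have L: "subspace ?L" unfolding lie_algebra_def by (rule G.subspace_tangent_space)
  have V: "subspace (?\<pi> ` ?L)" by (rule linear_subspace_image[OF linear_pi_xi L])
  have "linear_between ?L (?\<pi> ` ?L) ?\<pi>"
    by (rule linear_betweenI[OF L V]) (auto simp: pi_xi_add pi_xi_scale)
  moreover have "\<forall>P\<in>?\<pi> ` ?L. poisson_structure AM P \<and> (\<forall>x. bivector_rank AM x (P x) \<le> 2)"
    using poisson_structure_pi_xi[OF nc] rank_pi_xi by blast
  moreover have "\<forall>\<xi>\<in>?L. \<forall>x. sharp AM x (?\<pi> \<xi> x) (differential AM h x) = generator \<xi> x"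
    using sharp_pi_xi[OF nc] by (simp add: lie_algebra_def)
  ultimately show ?thesis using V by (intro exI[of _ "?\<pi> ` ?L"] conjI)
qed

end
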